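(* Let $N\ge 2$ be an integer and let $L$ be a scalar constant coefficient operator with Fourier symbol $\widehat L(k)=-k^{2N}$, so that the equation $u_{tt}=L[u]$ has the monomial dispersion relation $\omega(k)=\pm k^N$. Suppose that $f$ and $g$ are of bounded variation. Then, at each rational time $t^\ast=\pi p/q$ ($p,q$ positive integers with no common factors), the solution of $u_{tt}=L[u]$ on $0\le x\le2\pi$ with periodic boundary conditions and initial conditions $u(0,x)=f(x)$, $u_t(0,x)=g(x)$ takes the form $$u(t^\ast,x)=\sum_{j=0}^{2q-1}a_j\left(\frac pq\right)f\left(x-\frac{\pi j}{q}\right)+\langle g\rangle\,t^\ast+\sum_{j=0}^{2q-1}d_j\left(\frac pq\right)v\left(x-\frac{\pi j}{q}\right),$$ where $\langle g\rangle=\frac1{2\pi}\int_0^{2\pi}g(y)\,dy$, $v(x)=(g-\langle g\rangle)\ast Q_N(x)$, and the coefficients $a_j,d_j\in\mathbb{C}$, $j=0,\dots,2q-1$, are certain constants depending on $p,q$.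
   Context: Functions defined on $[0,2\pi]$ are extended $2\pi$-periodically to $\mathbb{R}$ when required; $g$ is not required to have zero mean. Fourier coefficients are $\widehat h(k)=\frac1{2\pi}\int_0^{2\pi}h(x)e^{-\mathrm{i}kx}\,dx$, $k\in\mathbb{Z}$. The $2\pi$-periodic convolution is $(f\ast g)(x)=\frac1{2\pi}\int_0^{2\pi}f(x-y)g(y)\,dy$. The polynomials $Q_N:[0,2\pi]\to\mathbb{C}$ of degree $N\ge1$ are defined inductively by $$Q_N(x)=\frac{(-\mathrm{i})^Nx^N}{(-1)^{N-1}N!}-\sum_{\ell=1}^{N-1}\frac{(-1)^{\ell-N}}{(-\mathrm{i})^{\ell-N}}\frac{(2\pi)^{N-\ell}}{(N-\ell+1)!}Q_\ell(x).$$ The solution of the periodic initial-boundary value problem is given by the Fourier series $$u(t,x)=\sum_{k}\widehat f(k)\cos(k^Nt)e^{\mathrm{i}kx}+\langle g\rangle\,t+\sum_{k\neq0}\frac{\widehat g(k)\sin(k^Nt)}{k^N}e^{\mathrm{i}kx}.$$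
   Formalization: The formula is proved for all x outside a countable set: those x where, for some j, the periodic f at x−πj/q is not the mean of its one-sided limits; at such jumps the identity can fail (e.g. f nonzero at a single point, g=0). *)

theory Defs
  imports "HOL-Analysis.Analysis"
begin

definition has_bounded_variation_on :: "(real \<Rightarrow> complex) \<Rightarrow> real \<Rightarrow> real \<Rightarrow> bool"
  where "has_bounded_variation_on h a b \<longleftrightarrow>
    (\<exists>M. \<forall>(n::nat) (s::nat \<Rightarrow> real).
        (\<forall>i\<le>n. s i \<in> {a..b}) \<and> (\<forall>i<n. s i \<le> s (Suc i)) \<longrightarrow>
        (\<Sum>i<n. norm (h (s (Suc i)) - h (s i))) \<le> M)"

text \<open>
  The periodic extension is taken from \<open>[0, 2\<pi>)\<close>; the value of \<open>h\<close> at \<open>2\<pi>\<close> is not used.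
\<close>

definition periodic_ext :: "(real \<Rightarrow> complex) \<Rightarrow> real \<Rightarrow> complex"
  where "periodic_ext h x = h (x - 2 * pi * of_int \<lfloor>x / (2 * pi)\<rfloor>)"

definition fourier_coeff :: "(real \<Rightarrow> complex) \<Rightarrow> int \<Rightarrow> complex"
  where "fourier_coeff h k =
    1 / (2 * of_real pi) * integral {0..2 * pi} (\<lambda>x. h x * exp (- \<i> * of_int k * of_real x))"

definition mean_value :: "(real \<Rightarrow> complex) \<Rightarrow> complex"
  where "mean_value h = 1 / (2 * of_real pi) * integral {0..2 * pi} h"

definition periodic_conv :: "(real \<Rightarrow> complex) \<Rightarrow> (real \<Rightarrow> complex) \<Rightarrow> real \<Rightarrow> complex"
  where "periodic_conv f g x =
    1 / (2 * of_real pi) * integral {0..2 * pi} (\<lambda>y. periodic_ext f (x - y) * periodic_ext g y)"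

text \<open>Only \<open>N \<ge> 1\<close> is meaningful; \<open>Q_poly 0\<close> is a dummy.\<close>

fun Q_poly :: "nat \<Rightarrow> real \<Rightarrow> complex"
  where "Q_poly N x =
    (- \<i>) ^ N * of_real x ^ N / ((- 1) ^ (N - 1) * fact N)
    - (\<Sum>l\<in>{1..<N}. (- 1) powi (int l - int N) / (- \<i>) powi (int l - int N)
          * (of_real (2 * pi) ^ (N - l) / fact (N - l + 1)) * Q_poly l x)"

declare Q_poly.simps [simp del]

text \<open>
  Bilateral series are summed by symmetric partial sums. For functions of bounded variation
  the Fourier series need not converge in any stronger pointwise sense.
\<close>

definition bilateral_sums :: "(int \<Rightarrow> complex) \<Rightarrow> complex \<Rightarrow> bool"
  where "bilateral_sums c s \<longleftrightarrow> (\<lambda>n::nat. \<Sum>k\<in>{- int n..int n}. c k) \<longlonglongrightarrow> s"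

text \<open>
  A scalar constant coefficient operator is represented by its Fourier symbol
  \<open>L :: int \<Rightarrow> complex\<close>, that is, \<open>L[exp(ikx)] = L k \<cdot> exp(ikx)\<close>. Then \<open>c k\<close> is the \<open>k\<close>-th
  Fourier mode of a solution of \<open>u\<^sub>t\<^sub>t = L[u]\<close>, \<open>u(0,\<cdot>) = f\<close>, \<open>u\<^sub>t(0,\<cdot>) = g\<close>.
\<close>

definition solution_modes ::
    "(int \<Rightarrow> complex) \<Rightarrow> (real \<Rightarrow> complex) \<Rightarrow> (real \<Rightarrow> complex) \<Rightarrow> (int \<Rightarrow> real \<Rightarrow> complex) \<Rightarrow> bool"
  where "solution_modes L f g c \<longleftrightarrow>
    (\<exists>c'. (\<forall>k t. (c k has_vector_derivative c' k t) (at t)) \<and>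
          (\<forall>k t. (c' k has_vector_derivative L k * c k t) (at t)) \<and>
          (\<forall>k. c k 0 = fourier_coeff f k) \<and>
          (\<forall>k. c' k 0 = fourier_coeff g k))"

text \<open>
  The solution is the sum of the Fourier series of its modes. Where that series diverges
  nothing is required of \<open>u\<close>; hence an identity \<open>u t x = r\<close> that holds for every \<open>u\<close> with
  \<open>periodic_solution L f g u\<close> says that the series converges at \<open>(t, x)\<close> with sum \<open>r\<close>. The
  lemma \<open>periodic_solution_iff\<close> below gives the explicit series when \<open>L k = -k\<^sup>2\<^sup>N\<close>.
\<close>

definition periodic_solution ::
    "(int \<Rightarrow> complex) \<Rightarrow> (real \<Rightarrow> complex) \<Rightarrow> (real \<Rightarrow> complex) \<Rightarrow> (real \<Rightarrow> real \<Rightarrow> complex) \<Rightarrow> bool"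
  where "periodic_solution L f g u \<longleftrightarrow>
    (\<exists>c. solution_modes L f g c \<and>
         (\<forall>t x s. bilateral_sums (\<lambda>k. c k t * exp (\<i> * of_int k * of_real x)) s \<longrightarrow> u t x = s))"

text \<open>
  The Fourier series of a function of bounded variation converges to the mean of the one-sided
  limits, so a pointwise identity between a Fourier sum and the function itself can only hold
  where the function equals that mean; this includes all points of continuity.
\<close>

definition equals_jump_mean_at :: "(real \<Rightarrow> complex) \<Rightarrow> real \<Rightarrow> bool"
  where "equals_jump_mean_at h y \<longleftrightarrow>
    (\<exists>l r. (h \<longlongrightarrow> l) (at_left y) \<and> (h \<longlongrightarrow> r) (at_right y) \<and> h y = (l + r) / 2)"

lemma equals_jump_mean_at_if_isCont: "isCont h y \<Longrightarrow> equals_jump_mean_at h y"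
  unfolding equals_jump_mean_at_def isCont_def
  by (rule exI[of _ "h y"], rule exI[of _ "h y"]) (auto intro: tendsto_mono at_le)

definition explicit_mode ::
    "nat \<Rightarrow> (real \<Rightarrow> complex) \<Rightarrow> (real \<Rightarrow> complex) \<Rightarrow> int \<Rightarrow> real \<Rightarrow> complex"
  where "explicit_mode N f g k t =
    fourier_coeff f k * of_real (cos (of_int k ^ N * t))
    + (if k = 0 then mean_value g * of_real t
       else fourier_coeff g k * of_real (sin (of_int k ^ N * t)) / of_int k ^ N)"

lemma fourier_coeff_0: "fourier_coeff h 0 = mean_value h"
  by (simp add: fourier_coeff_def mean_value_def)

lemma const_if_vector_derivative_0:
  fixes h :: "real \<Rightarrow> complex"
  assumes "\<And>t. (h has_vector_derivative 0) (at t)"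
  shows "h t = h 0"
proof -
  have "h constant_on UNIV"
    by (rule has_derivative_zero_connected_constant_on[where K="{}"])
       (use assms in \<open>auto simp: has_vector_derivative_def
          intro!: continuous_at_imp_continuous_on has_derivative_continuous\<close>)
  then show ?thesis by (auto simp: constant_on_def)
qed

lemma oscillator_unique:
  fixes c c' :: "real \<Rightarrow> complex" and w :: real
  assumes d: "\<And>t. (c has_vector_derivative c' t) (at t)"
    and d': "\<And>t. (c' has_vector_derivative - (of_real w)\<^sup>2 * c t) (at t)"
  shows "c t = c 0 * of_real (cos (w * t))
               + (if w = 0 then c' 0 * of_real t else c' 0 * of_real (sin (w * t)) / of_real w)"
proof (cases "w = 0")
  case True
  have c': "c' t = c' 0" for t
    using const_if_vector_derivative_0[of c'] d' True by simp
  have "((\<lambda>t. c t - c' 0 * of_real t) has_vector_derivative 0) (at t)" for t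
    using d[of t] c'[of t] by (auto intro!: derivative_eq_intros)
  from const_if_vector_derivative_0[OF this, of t] show ?thesis
    using True by (simp add: algebra_simps)
next
  case False
  define A where "A = (\<lambda>t. of_real w * c t * of_real (cos (w * t)) - c' t * of_real (sin (w * t)))"
  define B where "B = (\<lambda>t. of_real w * c t * of_real (sin (w * t)) + c' t * of_real (cos (w * t)))"
  have C: "((\<lambda>t. of_real (cos (w * t)) :: complex) has_vector_derivative
             of_real (- w * sin (w * t))) (at t)" for t
    by (rule has_vector_derivative_of_real)
       (auto intro!: derivative_eq_intros simp flip: has_real_derivative_iff_has_vector_derivative)
  have S: "((\<lambda>t. of_real (sin (w * t)) :: complex) has_vector_derivative
             of_real (w * cos (w * t))) (at t)" for t
    by (rule has_vector_derivative_of_real)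
       (auto intro!: derivative_eq_intros simp flip: has_real_derivative_iff_has_vector_derivative)
  have "(A has_vector_derivative 0) (at t)" for t
    unfolding A_def
    by (rule has_vector_derivative_eq_rhs,
        rule has_vector_derivative_diff,
        rule has_vector_derivative_mult[OF has_vector_derivative_mult_right[OF d] C],
        rule has_vector_derivative_mult[OF d' S])
       (simp add: algebra_simps power2_eq_square)
  then have A: "A t = of_real w * c 0"
    using const_if_vector_derivative_0[of A t] by (simp add: A_def)
  have "(B has_vector_derivative 0) (at t)" for t
    unfolding B_def
    by (rule has_vector_derivative_eq_rhs,
        rule has_vector_derivative_add,
        rule has_vector_derivative_mult[OF has_vector_derivative_mult_right[OF d] S],
        rule has_vector_derivative_mult[OF d' C])
       (simp add: algebra_simps power2_eq_square)
  then have B: "B t = c' 0"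
    using const_if_vector_derivative_0[of B t] by (simp add: B_def)
  have "A t * of_real (cos (w * t)) + B t * of_real (sin (w * t))
        = of_real w * c t * (of_real ((cos (w * t))\<^sup>2 + (sin (w * t))\<^sup>2))"
    unfolding A_def B_def of_real_add of_real_power by (simp only: algebra_simps power2_eq_square)
  also have "\<dots> = of_real w * c t"
    by (simp only: sin_cos_squared_add2 of_real_1 mult_1_right)
  finally show ?thesis using False A B by (simp add: field_simps)
qed

lemma explicit_mode_solution:
  assumes N: "N \<ge> 1" and L: "\<And>k. L k = - (of_int k ^ (2 * N))"
  shows "solution_modes L f g (explicit_mode N f g)"
proof -
  define w :: "int \<Rightarrow> real" where "w k = of_int k ^ N" for k
  have w0: "w k = 0 \<longleftrightarrow> k = 0" for k using N by (simp add: w_def)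
  have w00: "w 0 = 0" using w0 by blast
  have Lw: "L k = - (of_real (w k))\<^sup>2" for k
    by (simp add: L w_def power_mult mult.commute[of 2])
  define c' :: "int \<Rightarrow> real \<Rightarrow> complex" where "c' k t =
      fourier_coeff f k * of_real (- w k * sin (w k * t))
      + fourier_coeff g k * of_real (cos (w k * t))" for k t
  have e: "explicit_mode N f g k = (\<lambda>t. fourier_coeff f k * of_real (cos (w k * t))
    + fourier_coeff g k * of_real (if k = 0 then t else sin (w k * t) / w k))" for k
    by (auto simp: explicit_mode_def w_def fourier_coeff_0)
  have C: "((\<lambda>t. of_real (cos (w k * t)) :: complex) has_vector_derivative
             of_real (- w k * sin (w k * t))) (at t)" for k t
    by (rule has_vector_derivative_of_real)
       (auto intro!: derivative_eq_intros simp flip: has_real_derivative_iff_has_vector_derivative)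
  have S1: "((\<lambda>t. of_real (if k = 0 then t else sin (w k * t) / w k) :: complex)
             has_vector_derivative of_real (cos (w k * t))) (at t)" for k t
    by (rule has_vector_derivative_of_real, cases "k = 0")
       (auto intro!: derivative_eq_intros simp: w0 w00
          simp flip: has_real_derivative_iff_has_vector_derivative)
  have S2: "((\<lambda>t. of_real (- w k * sin (w k * t)) :: complex) has_vector_derivative
             of_real (- (w k)\<^sup>2 * cos (w k * t))) (at t)" for k t
    by (rule has_vector_derivative_of_real)
       (auto intro!: derivative_eq_intros simp: power2_eq_square
          simp flip: has_real_derivative_iff_has_vector_derivative)
  have "(explicit_mode N f g k has_vector_derivative c' k t) (at t)" for k t
    unfolding e c'_def
    by (intro has_vector_derivative_add has_vector_derivative_mult_right C S1)
  moreover have "(c' k has_vector_derivative L k * explicit_mode N f g k t) (at t)" for k t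
    unfolding e c'_def[abs_def]
    by (rule has_vector_derivative_eq_rhs,
        rule has_vector_derivative_add,
        rule has_vector_derivative_mult_right[OF S2],
        rule has_vector_derivative_mult_right[OF C])
       (use w0[of k] in \<open>auto simp: Lw algebra_simps power2_eq_square\<close>)
  moreover have "explicit_mode N f g k 0 = fourier_coeff f k" for k
    by (simp add: e)
  moreover have "c' k 0 = fourier_coeff g k" for k
    by (simp add: c'_def)
  ultimately show ?thesis unfolding solution_modes_def by blast
qed

lemma solution_modes_iff:
  assumes N: "N \<ge> 1" and L: "\<And>k. L k = - (of_int k ^ (2 * N))"
  shows "solution_modes L f g c \<longleftrightarrow> c = explicit_mode N f g"
proof
  assume "solution_modes L f g c"
  then obtain c' where c: "\<And>k t. (c k has_vector_derivative c' k t) (at t)"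
      "\<And>k t. (c' k has_vector_derivative L k * c k t) (at t)"
      "\<And>k. c k 0 = fourier_coeff f k" "\<And>k. c' k 0 = fourier_coeff g k"
    unfolding solution_modes_def by blast
  have Lw: "L k = - (of_real (of_int k ^ N))\<^sup>2" for k
    by (simp add: L power_mult mult.commute[of 2])
  show "c = explicit_mode N f g"
  proof (intro ext)
    fix k t
    show "c k t = explicit_mode N f g k t"
      using oscillator_unique[OF c(1)[of k] c(2)[of k, unfolded Lw], of t] N
      by (simp add: c(3,4) explicit_mode_def fourier_coeff_0)
  qed
qed (use explicit_mode_solution[OF assms] in auto)

lemma periodic_solution_iff:
  assumes "N \<ge> 1" and "\<And>k. L k = - (of_int k ^ (2 * N))"
  shows "periodic_solution L f g u \<longleftrightarrow>
    (\<forall>t x s. (\<lambda>n::nat.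
        (\<Sum>k\<in>{- int n..int n}. fourier_coeff f k * of_real (cos (of_int k ^ N * t))
                                  * exp (\<i> * of_int k * of_real x))
        + mean_value g * of_real t
        + (\<Sum>k\<in>{- int n..int n} - {0}. fourier_coeff g k * of_real (sin (of_int k ^ N * t))
                                  / of_int k ^ N * exp (\<i> * of_int k * of_real x))) \<longlonglongrightarrow> s
      \<longrightarrow> u t x = s)"
proof -
  have "(\<Sum>k\<in>{- int n..int n}. explicit_mode N f g k t * exp (\<i> * of_int k * of_real x)) =
        (\<Sum>k\<in>{- int n..int n}. fourier_coeff f k * of_real (cos (of_int k ^ N * t))
                                  * exp (\<i> * of_int k * of_real x))
        + mean_value g * of_real t
        + (\<Sum>k\<in>{- int n..int n} - {0}. fourier_coeff g k * of_real (sin (of_int k ^ N * t))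
                                  / of_int k ^ N * exp (\<i> * of_int k * of_real x))" for n :: nat and t x
    unfolding explicit_mode_def distrib_right sum.distrib add.assoc
    by (subst (2) sum.remove[of _ 0]) (auto intro!: sum.cong)
  then show ?thesis
    unfolding periodic_solution_def solution_modes_iff[OF assms] bilateral_sums_def by simp
qed

end

theory Submission
  imports Defs "HOL-Number_Theory.Cong"
begin

text \<open>
  At \<open>t = \<pi> p / q\<close> the factors \<open>cos (k\<^sup>N t)\<close> and \<open>sin (k\<^sup>N t)\<close> are \<open>2 q\<close>-periodic in \<open>k\<close>, so a
  discrete Fourier transform writes them as combinations of the characters
  \<open>exp (- i k \<pi> j / q)\<close>, and multiplying the \<open>k\<close>-th Fourier mode by such a character translates
  the function by \<open>\<pi> j / q\<close>. The factor \<open>1 / k\<^sup>N\<close> is the \<open>k\<close>-th Fourier coefficient of \<open>Q\<^sub>N\<close>,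
  and so belongs to a convolution with \<open>Q\<^sub>N\<close>; for \<open>N \<ge> 2\<close> that series converges absolutely. What
  remains is the Dirichlet-Jordan theorem on the convergence of the Fourier series of \<open>f\<close>. By the
  Jordan decomposition it reduces to monotone functions, where the second mean value theorem
  leaves only estimates of the primitive of the Dirichlet kernel.
\<close>

subsection \<open>The Dirichlet kernel\<close>

text \<open>The series of \<open>f\<close> may converge only conditionally, and it converges to the
  mean of the one-sided limits. So nothing is rearranged: the expansion into characters is finite
  and is applied inside each symmetric partial sum. Points where some translate of \<open>f\<close>
  misses that mean form an exceptional set, countable because monotone functions have countably many
  discontinuities. The part coming from \<open>g\<close> adds no exceptional points, since uniformly
  bounded partial sums of the series of \<open>Q_poly N\<close> let the limit pass through the
  convolution integral at every x. Subtracting the mean of \<open>g\<close> removes mode 0, where 1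
  / k^N has no meaning; that mode yields the term linear in t. For N \<ge> 1 the polynomials are
  Bernoulli polynomials in disguise: \<open>Q_poly N x\<close> is -(2\<pi>\<i>)^N / N! times B_N(x /
  2\<pi>) - B_N(0). The recursion is a triangular system that the numbers 1 / k^N satisfy as
  well.\<close>

definition dirichlet_kernel :: "nat \<Rightarrow> real \<Rightarrow> real"
  where "dirichlet_kernel n y = 1 + (\<Sum>k=1..n. 2 * cos (real k * y))"

text \<open>On (0, 2\<pi>) its limit in n is \<pi>, so the later estimates measure its distance from
  \<pi>.\<close>

definition dirichlet_primitive :: "nat \<Rightarrow> real \<Rightarrow> real"
  where "dirichlet_primitive n y = y + (\<Sum>k=1..n. 2 * sin (real k * y) / real k)"

lemma dirichlet_primitive_deriv [derivative_intros]:
  "(dirichlet_primitive n has_real_derivative dirichlet_kernel n y) (at y within A)"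
  unfolding dirichlet_primitive_def[abs_def] dirichlet_kernel_def
  by (auto intro!: derivative_eq_intros sum.cong)

lemma dirichlet_kernel_sin:
  "dirichlet_kernel n y * sin (y / 2) = sin ((real n + 1/2) * y)"
proof (induction n)
  case (Suc n)
  have "sin ((real (Suc n) + 1/2) * y) - sin ((real n + 1/2) * y)
        = 2 * cos (real (Suc n) * y) * sin (y / 2)"
  proof -
    have "((real (Suc n) + 1/2) * y - (real n + 1/2) * y) / 2 = y / 2"
      "((real (Suc n) + 1/2) * y + (real n + 1/2) * y) / 2 = real (Suc n) * y"
      by (simp_all add: algebra_simps add_divide_distrib)
    then show ?thesis unfolding sin_diff_sin by (simp only: mult.commute mult.left_commute)
  qed
  then show ?case using Suc by (simp add: dirichlet_kernel_def algebra_simps)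
qed (simp add: dirichlet_kernel_def)

lemma dirichlet_kernel_minus [simp]: "dirichlet_kernel n (- y) = dirichlet_kernel n y"
  by (simp add: dirichlet_kernel_def)

lemma cos_periodic_int: "cos (x + 2 * pi * of_int m) = cos (x :: real)"
  by (simp add: cos_add)

lemma dirichlet_kernel_periodic: "dirichlet_kernel n (y - 2 * pi) = dirichlet_kernel n y"
proof -
  have "cos (real k * (y - 2 * pi)) = cos (real k * y)" for k
    using cos_periodic_int[of "real k * y" "- int k"] by (simp add: algebra_simps)
  then show ?thesis by (simp add: dirichlet_kernel_def)
qed

lemma continuous_on_dirichlet_kernel [continuous_intros]: "continuous_on A (dirichlet_kernel n)"
  unfolding dirichlet_kernel_def[abs_def] by (intro continuous_intros)

lemma dirichlet_kernel_integral:
  "a \<le> b \<Longrightarrow> (dirichlet_kernel n has_integral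
     dirichlet_primitive n b - dirichlet_primitive n a) {a..b}"
  by (rule fundamental_theorem_of_calculus)
     (simp_all add: dirichlet_primitive_deriv flip: has_real_derivative_iff_has_vector_derivative)

lemma dirichlet_primitive_0 [simp]: "dirichlet_primitive n 0 = 0"
  by (simp add: dirichlet_primitive_def)

lemma dirichlet_primitive_pi: "dirichlet_primitive n pi = pi"
  by (simp add: dirichlet_primitive_def)

text \<open>The symmetry that carries the estimate around \<pi> from (0, \<pi>] to the rest of the
  period; sin (y / 2) agrees at reflected points.\<close>

lemma dirichlet_primitive_reflect:
  "dirichlet_primitive n (2 * pi - y) = 2 * pi - dirichlet_primitive n y"
proof -
  have "sin (real k * (2 * pi - y)) = - sin (real k * y)" for k
  proof -
    have "sin (2 * pi * real k - real k * y) = - sin (real k * y)"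
      using sin_integer_2pi[of "real k"] cos_integer_2pi[of "real k"]
      by (simp add: sin_diff del: sin_integer_2pi cos_integer_2pi)
    then show ?thesis by (simp add: algebra_simps)
  qed
  then show ?thesis
    by (simp add: dirichlet_primitive_def sum_negf)
qed

text \<open>
  With \<open>\<omega> = n + 1/2\<close>, adding \<open>cos (\<omega> u) / (\<omega> sin (u / 2))\<close> to the primitive gives a function
  that equals \<open>\<pi>\<close> at \<open>u = \<pi>\<close> and whose derivative is dominated by that of \<open>1 / (\<omega> sin (u / 2))\<close>.
\<close>

lemma dirichlet_primitive_near_pi_aux:
  assumes y: "0 < y" "y \<le> pi"
  shows "\<bar>dirichlet_primitive n y - pi\<bar> \<le> 2 / ((real n + 1/2) * sin (y / 2))"
proof -
  define w where "w = real n + 1/2"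
  have w: "w > 0" by (simp add: w_def)
  define B where "B = (\<lambda>u. 1 / (w * sin (u / 2)))"
  define H where "H = (\<lambda>u. dirichlet_primitive n u + cos (w * u) * B u)"
  have s: "sin (u / 2) > 0" if "y \<le> u" "u \<le> pi" for u
    using that y by (intro sin_gt_zero) auto
  have c: "cos (u / 2) \<ge> 0" if "y \<le> u" "u \<le> pi" for u
    using that y by (intro cos_ge_zero) auto
  have dB: "(B has_real_derivative - cos (u / 2) / (2 * w * (sin (u / 2))\<^sup>2)) (at u)"
    if "y \<le> u" "u \<le> pi" for u
    unfolding B_def using s[OF that] w
    by (auto intro!: derivative_eq_intros simp: field_simps power2_eq_square)
  have dH: "(H has_real_derivative - cos (w * u) * cos (u / 2) / (2 * w * (sin (u / 2))\<^sup>2)) (at u)"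
    if "y \<le> u" "u \<le> pi" for u
  proof -
    have "dirichlet_kernel n u = sin (w * u) / sin (u / 2)"
      using dirichlet_kernel_sin[of n u] s[OF that] by (simp add: field_simps w_def)
    then have "sin (w * u) * B u * w = dirichlet_kernel n u"
      using s[OF that] w by (simp add: B_def)
    then show ?thesis
      unfolding H_def using s[OF that] w
      by (auto intro!: derivative_eq_intros dB[OF that] simp: algebra_simps)
  qed
  \<comment> \<open>Domination of the derivatives makes H - B nondecreasing and H + B nonincreasing.
    Comparison with u = \<pi> puts H y within B y of \<pi>, and removing the cosine correction costs
    another B y: hence the constant 2.\<close>
  have "H y - B y \<le> H pi - B pi"
  proof (rule DERIV_nonneg_imp_nondecreasing[OF y(2)])
    fix u assume u: "y \<le> u" "u \<le> pi"
    have "((\<lambda>u. H u - B u) has_real_derivative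
      (1 - cos (w * u)) * cos (u / 2) / (2 * w * (sin (u / 2))\<^sup>2)) (at u)"
      by (rule DERIV_cong[OF DERIV_diff[OF dH[OF u] dB[OF u]]])
         (simp add: diff_divide_distrib left_diff_distrib)
    moreover have "(1 - cos (w * u)) * cos (u / 2) / (2 * w * (sin (u / 2))\<^sup>2) \<ge> 0"
      using c[OF u] w by (intro divide_nonneg_nonneg mult_nonneg_nonneg) auto
    ultimately show "\<exists>d. ((\<lambda>u. H u - B u) has_real_derivative d) (at u) \<and> d \<ge> 0" by blast
  qed
  moreover have "H y + B y \<ge> H pi + B pi"
  proof (rule DERIV_nonpos_imp_nonincreasing[OF y(2)])
    fix u assume u: "y \<le> u" "u \<le> pi"
    have "((\<lambda>u. H u + B u) has_real_derivative
      - ((1 + cos (w * u)) * cos (u / 2) / (2 * w * (sin (u / 2))\<^sup>2))) (at u)"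
      by (rule DERIV_cong[OF DERIV_add[OF dH[OF u] dB[OF u]]])
         (simp add: add_divide_distrib distrib_right)
    moreover have "1 + cos (w * u) \<ge> 0"
      using cos_ge_minus_one[of "w * u"] by linarith
    then have "(1 + cos (w * u)) * cos (u / 2) / (2 * w * (sin (u / 2))\<^sup>2) \<ge> 0"
      using c[OF u] w by (intro divide_nonneg_nonneg mult_nonneg_nonneg) auto
    ultimately show "\<exists>d. ((\<lambda>u. H u + B u) has_real_derivative d) (at u) \<and> d \<le> 0"
      by (metis neg_le_0_iff_le)
  qed
  moreover have "H pi = pi"
  proof -
    have "cos (w * pi) = 0"
      by (simp add: w_def distrib_right cos_add)
    then show ?thesis by (simp add: H_def dirichlet_primitive_pi)
  qed
  moreover have "B pi \<ge> 0" using w by (simp add: B_def)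
  moreover have "\<bar>cos (w * y) * B y\<bar> \<le> B y"
  proof -
    have "B y \<ge> 0" using s[of y] y w by (simp add: B_def)
    then show ?thesis by (simp add: abs_mult mult_left_le_one_le)
  qed
  moreover have "dirichlet_primitive n y = H y - cos (w * y) * B y" by (simp add: H_def)
  ultimately have "\<bar>dirichlet_primitive n y - pi\<bar> \<le> 2 * B y" by linarith
  then show ?thesis by (simp add: B_def w_def)
qed

lemma dirichlet_primitive_near_pi:
  assumes y: "0 < y" "y < 2 * pi"
  shows "\<bar>dirichlet_primitive n y - pi\<bar> \<le> 2 / ((real n + 1/2) * sin (y / 2))"
proof (cases "y \<le> pi")
  case True
  then show ?thesis using dirichlet_primitive_near_pi_aux y by blast
next
  case False
  have "sin ((2 * pi - y) / 2) = sin (y / 2)"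
    using sin_pi_minus[of "y / 2"] by (simp add: diff_divide_distrib)
  then show ?thesis
    using dirichlet_primitive_near_pi_aux[of "2 * pi - y" n] False y
    by (simp add: dirichlet_primitive_reflect abs_minus_commute)
qed

lemma sin_half_ge:
  assumes "0 \<le> y" "y \<le> (1::real)"
  shows "y / 4 \<le> sin (y / 2)"
proof -
  have "sin (0 / 2) - 0 / 4 \<le> sin (y / 2) - y / 4"
  proof (rule DERIV_nonneg_imp_nondecreasing[OF assms(1)])
    fix u assume u: "0 \<le> u" "u \<le> y"
    have "cos (pi / 3) \<le> cos (u / 2)"
      using u assms pi_gt3 by (intro cos_monotone_0_pi_le) auto
    then have "cos (u / 2) / 2 - 1 / 4 \<ge> 0" by (simp add: cos_60)
    moreover have "((\<lambda>u. sin (u / 2) - u / 4) has_real_derivative cos (u / 2) / 2 - 1 / 4) (at u)"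
      by (auto intro!: derivative_eq_intros)
    ultimately show "\<exists>d. ((\<lambda>u. sin (u / 2) - u / 4) has_real_derivative d) (at u) \<and> d \<ge> 0"
      by blast
  qed
  then show ?thesis by simp
qed

text \<open>The estimate by 1 / sin (y / 2) blows up at 0, so a bound uniform in n needs a second
  argument there. If (n + 1/2) y \<le> 1, the inequality |sin u| \<le> |u| in each term bounds the
  primitive by 2; otherwise sin (y / 2) \<ge> y / 4 turns the earlier estimate into 8 / ((n + 1/2)
  y) < 8.\<close>

lemma dirichlet_primitive_bounded:
  assumes y: "0 \<le> y" "y \<le> 1"
  shows "\<bar>dirichlet_primitive n y - pi\<bar> \<le> 8"
proof (cases "(real n + 1/2) * y \<le> 1")
  case True
  have "\<bar>dirichlet_primitive n y\<bar> \<le> y + (\<Sum>k=1..n. \<bar>2 * sin (real k * y) / real k\<bar>)"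
    unfolding dirichlet_primitive_def using y sum_abs[of "\<lambda>k. 2 * sin (real k * y) / real k" "{1..n}"]
    by linarith
  also have "(\<Sum>k=1..n. \<bar>2 * sin (real k * y) / real k\<bar>) \<le> (\<Sum>k=1..n. 2 * y)"
  proof (rule sum_mono)
    fix k assume "k \<in> {1..n}"
    then have k: "real k > 0" by simp
    have "\<bar>sin (real k * y)\<bar> \<le> real k * y"
      using abs_sin_x_le_abs_x[of "real k * y"] y k by (simp add: abs_mult)
    then show "\<bar>2 * sin (real k * y) / real k\<bar> \<le> 2 * y"
      using k by (simp add: abs_mult field_simps)
  qed
  finally have "\<bar>dirichlet_primitive n y\<bar> \<le> 2 * ((real n + 1/2) * y)"
    by (simp add: algebra_simps)
  then show ?thesis using True pi_less_4 pi_gt3 by linarith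
next
  case False
  then have y0: "y > 0" using y by (cases "y = 0") auto
  have "\<bar>dirichlet_primitive n y - pi\<bar> \<le> 2 / ((real n + 1/2) * sin (y / 2))"
    using y y0 pi_gt3 by (intro dirichlet_primitive_near_pi) auto
  also have "\<dots> \<le> 2 / ((real n + 1/2) * (y / 4))"
    using sin_half_ge[OF y] y0 by (intro divide_left_mono mult_left_mono mult_pos_pos) (auto simp: add_pos_nonneg)
  also have "\<dots> \<le> 8"
    using False y0 by (simp add: field_simps)
  finally show ?thesis .
qed

section \<open>Dirichlet integrals of monotone functions\<close>

lemma tendsto_dirichlet_bound:
  assumes "m > 0"
  shows "(\<lambda>n. 2 / ((real n + 1/2) * m)) \<longlonglongrightarrow> 0"
proof -
  have "filterlim (\<lambda>n. (real n + 1/2) * m) at_top sequentially"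
    using assms by (intro filterlim_at_top_mult_tendsto_pos[OF tendsto_const]
         filterlim_tendsto_add_at_top[OF tendsto_const, of _ _ "1/2", simplified add.commute]
         filterlim_real_sequentially) auto
  then show ?thesis
    by (intro tendsto_divide_0[OF tendsto_const] filterlim_at_top_imp_at_infinity)
qed

lemma abs_mult_diff_le:
  fixes x X u v c B :: real
  assumes "0 \<le> x" "x \<le> X" "\<bar>u - c\<bar> \<le> B" "\<bar>v - c\<bar> \<le> B"
  shows "\<bar>x * (u - v)\<bar> \<le> X * (2 * B)"
  unfolding abs_mult using assms by (intro mult_mono) auto

text \<open>The integrals of the absolute value of the kernel are not bounded in n, so smallness of
  g near 0 cannot be used under an absolute value. The second mean value theorem replaces the kernel
  by increments of its primitive: on [0, d] these are bounded while g is small, on [d, b] they tend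
  to 0 uniformly while g is bounded.\<close>

lemma dirichlet_kernel_mono_limit_0:
  fixes g :: "real \<Rightarrow> real"
  assumes g: "mono g" and g0: "g 0 = 0" and lim: "(g \<longlongrightarrow> 0) (at_right 0)" and b: "0 < b" "b < 2 * pi"
  shows "(\<lambda>n. integral {0..b} (\<lambda>y. g y * dirichlet_kernel n y)) \<longlonglongrightarrow> 0"
proof (rule LIMSEQ_I)
  fix e :: real assume e: "e > 0"
  \<comment> \<open>On [0, d] the increments of the primitive are at most 2 * 8, so a bound e / 32
    for g costs e / 2.\<close>
  have "eventually (\<lambda>y. g y < e / 32) (at_right 0)"
    using order_tendstoD(2)[OF lim, of "e / 32"] e by simp
  then obtain d' where d': "d' > 0" "\<And>y. 0 < y \<Longrightarrow> y < d' \<Longrightarrow> g y < e / 32"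
    unfolding eventually_at_right[OF zero_less_one] by auto
  define d where "d = min (d' / 2) (min 1 (b / 2))"
  have d: "0 < d" "d \<le> 1" "d < b" "d < d'" using d' b by (auto simp: d_def)
  have gd: "0 \<le> g d" "g d < e / 32" using d' d monoD[OF g, of 0 d] g0 by auto
  have gb: "0 \<le> g b" using monoD[OF g, of 0 b] b g0 by auto
  \<comment> \<open>b < 2\<pi> keeps y / 2 inside (0, \<pi>), so sin (y / 2) has a positive minimum
    on [d, b] and the estimate becomes uniform in y.\<close>
  obtain m where m: "m > 0" "\<And>y. d \<le> y \<Longrightarrow> y \<le> b \<Longrightarrow> m \<le> sin (y / 2)"
  proof -
    have "continuous_on {d..b} (\<lambda>y. sin (y / 2))" by (intro continuous_intros) auto
    from continuous_attains_inf[OF compact_Icc _ this] d obtain z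
      where z: "z \<in> {d..b}" "\<forall>y\<in>{d..b}. sin (z / 2) \<le> sin (y / 2)" by auto
    show thesis
      by (rule that[of "sin (z / 2)"]) (use z d b in \<open>auto intro!: sin_gt_zero\<close>)
  qed
  have near: "\<bar>dirichlet_primitive n y - pi\<bar> \<le> 2 / ((real n + 1/2) * m)" if "d \<le> y" "y \<le> b" for n y
  proof -
    have "\<bar>dirichlet_primitive n y - pi\<bar> \<le> 2 / ((real n + 1/2) * sin (y / 2))"
      using that d b by (intro dirichlet_primitive_near_pi) auto
    also have "\<dots> \<le> 2 / ((real n + 1/2) * m)"
      using m(1) m(2)[OF that] by (intro divide_left_mono mult_left_mono mult_pos_pos) auto
    finally show ?thesis .
  qed
  have ev: "eventually (\<lambda>n. g b * (2 * (2 / ((real n + 1/2) * m))) + g d * (2 * (2 / ((real n + 1/2) * m))) < e / 2) sequentially"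
  proof -
    note tendsto_dirichlet_bound[OF m(1)]
    then have "(\<lambda>n. g b * (2 * (2 / ((real n + 1/2) * m))) + g d * (2 * (2 / ((real n + 1/2) * m)))) \<longlonglongrightarrow> g b * (2 * 0) + g d * (2 * 0)"
      by (intro tendsto_add tendsto_mult tendsto_const)
    from order_tendstoD(2)[OF this, of "e / 2"] e show ?thesis by (simp only: mult_zero_right add_0_right half_gt_zero)
  qed
  have int: "integral {u..v} (dirichlet_kernel n) = dirichlet_primitive n v - dirichlet_primitive n u"
    if "u \<le> v" for u v n
    using dirichlet_kernel_integral[OF that] by blast
  have bound: "\<bar>integral {0..b} (\<lambda>y. g y * dirichlet_kernel n y)\<bar>
     \<le> e / 2 + (g b * (2 * (2 / ((real n + 1/2) * m))) + g d * (2 * (2 / ((real n + 1/2) * m))))" for n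
  proof -
    have D: "dirichlet_kernel n integrable_on {u..v}" for u v
      by (intro integrable_continuous_real continuous_on_dirichlet_kernel)
    obtain c where c: "c \<in> {0..d}" "((\<lambda>y. g y * dirichlet_kernel n y) has_integral
        (g 0 * integral {0..c} (dirichlet_kernel n) + g d * integral {c..d} (dirichlet_kernel n))) {0..d}"
      using second_mean_value_theorem_full[OF D[of 0 d], of g] d monoD[OF g] by auto
    obtain c' where c': "c' \<in> {d..b}" "((\<lambda>y. g y * dirichlet_kernel n y) has_integral
        (g d * integral {d..c'} (dirichlet_kernel n) + g b * integral {c'..b} (dirichlet_kernel n))) {d..b}"
      using second_mean_value_theorem_full[OF D[of d b], of g] d monoD[OF g] by auto
    have "integral {0..b} (\<lambda>y. g y * dirichlet_kernel n y) =
      g d * (dirichlet_primitive n d - dirichlet_primitive n c)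
      + (g d * (dirichlet_primitive n c' - dirichlet_primitive n d)
         + g b * (dirichlet_primitive n b - dirichlet_primitive n c'))"
      using has_integral_combine[OF _ _ c(2) c'(2)] d c c' g0 by (intro integral_unique) (simp add: int)
    moreover have "\<bar>g d * (dirichlet_primitive n d - dirichlet_primitive n c)\<bar> \<le> e / 32 * (2 * 8)"
      using gd c d by (intro abs_mult_diff_le[where c = pi] dirichlet_primitive_bounded) auto
    moreover have "\<bar>g d * (dirichlet_primitive n c' - dirichlet_primitive n d)\<bar> \<le> g d * (2 * (2 / ((real n + 1/2) * m)))"
      using gd c' d by (intro abs_mult_diff_le[where c = pi] near) auto
    moreover have "\<bar>g b * (dirichlet_primitive n b - dirichlet_primitive n c')\<bar> \<le> g b * (2 * (2 / ((real n + 1/2) * m)))"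
      using gb c' d by (intro abs_mult_diff_le[where c = pi] near) auto
    ultimately show ?thesis by linarith
  qed
  from ev obtain n0 where "\<And>n. n \<ge> n0 \<Longrightarrow> g b * (2 * (2 / ((real n + 1/2) * m))) + g d * (2 * (2 / ((real n + 1/2) * m))) < e / 2"
    unfolding eventually_sequentially by blast
  then have "\<bar>integral {0..b} (\<lambda>y. g y * dirichlet_kernel n y)\<bar> < e" if "n \<ge> n0" for n
    using bound[of n] that by (smt (verit) field_sum_of_halves)
  then show "\<exists>n0. \<forall>n\<ge>n0. norm (integral {0..b} (\<lambda>y. g y * dirichlet_kernel n y) - 0) < e"
    by auto
qed

text \<open>The second mean value theorem already asserts that the product has an integral.\<close>

lemma mono_times_integrable:
  fixes f \<phi> :: "real \<Rightarrow> real"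
  assumes "mono f" "\<phi> integrable_on {a..b}"
  shows "(\<lambda>x. f x * \<phi> x) integrable_on {a..b}"
proof (cases "a \<le> b")
  case True
  then show ?thesis
    using second_mean_value_theorem_full[OF assms(2) True, of f] monoD[OF assms(1)] by blast
qed auto

lemma dirichlet_primitive_tendsto:
  assumes "0 < b" "b < 2 * pi"
  shows "(\<lambda>n. dirichlet_primitive n b) \<longlonglongrightarrow> pi"
proof -
  have s: "sin (b / 2) > 0" using assms by (intro sin_gt_zero) auto
  note tendsto_dirichlet_bound[OF s]
  then have "(\<lambda>n. dirichlet_primitive n b - pi) \<longlonglongrightarrow> 0"
    by (rule Lim_null_comparison[rotated]) (use dirichlet_primitive_near_pi[OF assms] in simp)
  then show ?thesis by (simp add: LIM_zero_iff)
qed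

lemma dirichlet_kernel_mono_limit:
  fixes f :: "real \<Rightarrow> real"
  assumes f: "mono f" and lim: "(f \<longlongrightarrow> l) (at_right 0)" and b: "0 < b" "b < 2 * pi"
  shows "(\<lambda>n. integral {0..b} (\<lambda>y. f y * dirichlet_kernel n y)) \<longlonglongrightarrow> pi * l"
proof -
  \<comment> \<open>\<open>f 0\<close> may lie below the right limit l. Cutting off to 0 for y \<le>
    0 keeps monotonicity because f \<ge> l on the positive axis, and alters f - l on {0..b} at most
    at 0.\<close>
  define g where "g y = (if y \<le> 0 then 0 else f y - l)" for y
  have ge: "l \<le> f y" if "y > 0" for y
  proof (rule tendsto_upperbound[OF lim])
    show "eventually (\<lambda>u. f u \<le> f y) (at_right 0)"
      unfolding eventually_at_right[OF zero_less_one] using that monoD[OF f] by (intro exI[of _ y]) auto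
  qed auto
  have "mono g"
    using ge monoD[OF f] by (auto simp: g_def mono_def)
  moreover have "(g \<longlongrightarrow> 0) (at_right 0)"
  proof (rule Lim_transform_eventually)
    show "((\<lambda>y. f y - l) \<longlongrightarrow> 0) (at_right 0)" using lim by (simp add: LIM_zero)
    show "eventually (\<lambda>y. f y - l = g y) (at_right 0)"
      unfolding eventually_at_right[OF zero_less_one] by (auto simp: g_def intro: exI[of _ 1])
  qed
  ultimately have "(\<lambda>n. integral {0..b} (\<lambda>y. g y * dirichlet_kernel n y) + l * dirichlet_primitive n b) \<longlonglongrightarrow> 0 + l * pi"
    using b by (intro tendsto_add tendsto_mult tendsto_const dirichlet_kernel_mono_limit_0
        dirichlet_primitive_tendsto) (simp_all add: g_def[of 0])
  moreover have "integral {0..b} (\<lambda>y. g y * dirichlet_kernel n y) + l * dirichlet_primitive n b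
     = integral {0..b} (\<lambda>y. f y * dirichlet_kernel n y)" for n
  proof -
    have D: "(dirichlet_kernel n has_integral dirichlet_primitive n b) {0..b}"
      using dirichlet_kernel_integral[of 0 b n] b by simp
    have "((\<lambda>y. g y * dirichlet_kernel n y + l * dirichlet_kernel n y) has_integral
        (integral {0..b} (\<lambda>y. g y * dirichlet_kernel n y) + l * dirichlet_primitive n b)) {0..b}"
      by (intro has_integral_add integrable_integral mono_times_integrable \<open>mono g\<close>
            has_integral_mult_right D has_integral_integrable[OF D])
    then have "((\<lambda>y. f y * dirichlet_kernel n y) has_integral
        (integral {0..b} (\<lambda>y. g y * dirichlet_kernel n y) + l * dirichlet_primitive n b)) {0..b}"
      by (rule has_integral_spike[of "{0}", rotated 2]) (auto simp: g_def algebra_simps)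
    then show ?thesis by (simp add: integral_unique)
  qed
  ultimately show ?thesis by (simp add: mult.commute)
qed

lemma mono_limit_right:
  fixes m :: "real \<Rightarrow> real"
  assumes "mono m"
  obtains r where "(m \<longlongrightarrow> r) (at_right x)"
  using Lim_right_bound[of UNIV x m "m x"] monoD[OF assms] by (auto intro: less_imp_le)

lemma mono_limit_left:
  fixes m :: "real \<Rightarrow> real"
  assumes "mono m"
  obtains l where "(m \<longlongrightarrow> l) (at_left x)"
  using Lim_left_bound[of UNIV x m "m x"] monoD[OF assms] by (auto intro: less_imp_le)

lemma dirichlet_limit_right:
  fixes m :: "real \<Rightarrow> real"
  assumes m: "mono m" and lim: "(m \<longlongrightarrow> r) (at_right x)" and b: "0 < b" "b < 2 * pi"
  shows "(\<lambda>n. integral {x..x + b} (\<lambda>y. m y * dirichlet_kernel n (y - x))) \<longlonglongrightarrow> pi * r"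
proof -
  have "mono (\<lambda>u. m (u + x))" using m by (auto simp: mono_def)
  moreover have "((\<lambda>u. m (u + x)) \<longlongrightarrow> r) (at_right 0)"
    using lim by (simp add: filterlim_at_right_to_0[of m _ x])
  ultimately have "(\<lambda>n. integral {0..b} (\<lambda>u. m (u + x) * dirichlet_kernel n u)) \<longlonglongrightarrow> pi * r"
    using b by (rule dirichlet_kernel_mono_limit)
  moreover have "integral {0..b} (\<lambda>u. m (u + x) * dirichlet_kernel n u)
    = integral {x..x + b} (\<lambda>y. m y * dirichlet_kernel n (y - x))" for n
  proof -
    have "(\<lambda>y. m y * dirichlet_kernel n (y - x)) integrable_on {x..x + b}"
      by (intro mono_times_integrable[OF m] integrable_continuous_real
            continuous_on_compose2[OF continuous_on_dirichlet_kernel[of UNIV]] continuous_intros) auto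
    from integrable_integral[OF this]
    have "(((\<lambda>y. m y * dirichlet_kernel n (y - x)) \<circ> (+) x) has_integral
        integral {x..x + b} (\<lambda>y. m y * dirichlet_kernel n (y - x))) {0..b}"
      by (simp add: has_integral_shift_Icc_real add.commute)
    then show ?thesis by (simp add: o_def add.commute integral_unique)
  qed
  ultimately show ?thesis by simp
qed

lemma dirichlet_limit_left:
  fixes m :: "real \<Rightarrow> real"
  assumes m: "mono m" and lim: "(m \<longlongrightarrow> l) (at_left x)" and b: "0 < b" "b < 2 * pi"
  shows "(\<lambda>n. integral {x - b..x} (\<lambda>y. m y * dirichlet_kernel n (y - x))) \<longlonglongrightarrow> pi * l"
proof -
  \<comment> \<open>Reflection alone would make m decreasing; the extra sign restores monotonicity,
    and left limits become right limits.\<close>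
  have "mono (\<lambda>u. - m (- u))" using m by (auto simp: mono_def)
  moreover have "((\<lambda>u. - m (- u)) \<longlongrightarrow> - l) (at_right (- x))"
    using lim by (intro tendsto_minus) (simp add: filterlim_at_left_to_right)
  ultimately have "(\<lambda>n. integral {- x..- x + b} (\<lambda>y. - m (- y) * dirichlet_kernel n (y - - x))) \<longlonglongrightarrow> pi * - l"
    using b by (rule dirichlet_limit_right)
  moreover have "integral {- x..- x + b} (\<lambda>y. - m (- y) * dirichlet_kernel n (y - - x))
     = - integral {x - b..x} (\<lambda>y. m y * dirichlet_kernel n (y - x))" for n
  proof -
    have "dirichlet_kernel n (y - - x) = dirichlet_kernel n (- y - x)" for y
      using dirichlet_kernel_minus[of n "y + x"] by simp
    then show ?thesis
      using Henstock_Kurzweil_Integration.integral_reflect_real[of x "x - b" "\<lambda>y. m y * dirichlet_kernel n (y - x)"] by simp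
  qed
  ultimately show ?thesis by (simp add: tendsto_minus_cancel_left)
qed

subsection \<open>Fourier series of functions of bounded variation\<close>

definition fourier_sum :: "(real \<Rightarrow> complex) \<Rightarrow> nat \<Rightarrow> real \<Rightarrow> complex"
  where "fourier_sum h n x = (\<Sum>k\<in>{- int n..int n}. fourier_coeff h k * exp (\<i> * of_int k * of_real x))"

lemma sum_symmetric_Suc:
  fixes F :: "int \<Rightarrow> 'a :: comm_monoid_add"
  shows "(\<Sum>k\<in>{- int (Suc n)..int (Suc n)}. F k)
     = (\<Sum>k\<in>{- int n..int n}. F k) + (F (int (Suc n)) + F (- int (Suc n)))"
proof -
  have "{- int (Suc n)..int (Suc n)} = insert (int (Suc n)) (insert (- int (Suc n)) {- int n..int n})"
    by auto
  then show ?thesis by (simp add: add_ac)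
qed

lemma exp_sum_dirichlet_kernel:
  "(\<Sum>k\<in>{- int n..int n}. exp (\<i> * of_int k * of_real y)) = of_real (dirichlet_kernel n y)"
proof (induction n)
  case (Suc n)
  have "exp (\<i> * of_int (int (Suc n)) * of_real y) + exp (\<i> * of_int (- int (Suc n)) * of_real y)
     = of_real (2 * cos (real (Suc n) * y))"
  proof -
    define z where "z = real (Suc n) * y"
    have "exp (\<i> * of_int (int (Suc n)) * of_real y) = cis z"
      "exp (\<i> * of_int (- int (Suc n)) * of_real y) = cis (- z)"
      unfolding cis_conv_exp z_def by (simp_all add: algebra_simps)
    then show ?thesis unfolding z_def[symmetric] by (simp add: complex_eq_iff)
  qed
  then show ?case using Suc unfolding sum_symmetric_Suc
    by (simp add: dirichlet_kernel_def)
qed (simp add: dirichlet_kernel_def)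

text \<open>
  What the proof needs of a function of bounded variation, in a form that passes from monotone
  functions to their linear combinations.
\<close>

definition fourier_regular :: "(real \<Rightarrow> complex) \<Rightarrow> bool"
  where "fourier_regular h \<longleftrightarrow>
    (\<forall>\<phi>. continuous_on {0..2 * pi} \<phi> \<longrightarrow> (\<lambda>x. h x * \<phi> x) integrable_on {0..2 * pi}) \<and>
    bounded (h ` {0..2 * pi}) \<and>
    countable {x. \<not> isCont (periodic_ext h) x} \<and>
    (\<forall>x. \<exists>l r. (periodic_ext h \<longlongrightarrow> l) (at_left x) \<and> (periodic_ext h \<longlongrightarrow> r) (at_right x) \<and>
           (\<lambda>n. fourier_sum h n x) \<longlonglongrightarrow> (l + r) / 2)"

lemma fourier_regularD:
  assumes "fourier_regular h"
  shows fourier_regular_integrable: "continuous_on {0..2 * pi} \<phi> \<Longrightarrow> (\<lambda>x. h x * \<phi> x) integrable_on {0..2 * pi}"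
    and fourier_regular_bounded: "bounded (h ` {0..2 * pi})"
    and fourier_regular_countable: "countable {x. \<not> isCont (periodic_ext h) x}"
  using assms by (auto simp: fourier_regular_def)

lemma fourier_regular_limit:
  assumes "fourier_regular h" "equals_jump_mean_at (periodic_ext h) x"
  shows "(\<lambda>n. fourier_sum h n x) \<longlonglongrightarrow> periodic_ext h x"
proof -
  obtain l r where 1: "(periodic_ext h \<longlongrightarrow> l) (at_left x)" "(periodic_ext h \<longlongrightarrow> r) (at_right x)"
      "(\<lambda>n. fourier_sum h n x) \<longlonglongrightarrow> (l + r) / 2"
    using assms(1) unfolding fourier_regular_def by blast
  obtain l' r' where 2: "(periodic_ext h \<longlongrightarrow> l') (at_left x)" "(periodic_ext h \<longlongrightarrow> r') (at_right x)"
      "periodic_ext h x = (l' + r') / 2"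
    using assms(2) unfolding equals_jump_mean_at_def by blast
  have "l = l'" "r = r'"
    using 1 2 tendsto_unique trivial_limit_at_left_real trivial_limit_at_right_real by blast+
  then show ?thesis using 1(3) 2(3) by (simp only:)
qed

section \<open>Periodic extension and linearity of \<open>fourier_regular\<close>\<close>

lemma periodic_ext_range: "x - 2 * pi * of_int \<lfloor>x / (2 * pi)\<rfloor> \<in> {0..<2 * pi}"
proof -
  have "of_int \<lfloor>x / (2 * pi)\<rfloor> \<le> x / (2 * pi)" "x / (2 * pi) < of_int \<lfloor>x / (2 * pi)\<rfloor> + 1"
    by linarith+
  then have "of_int \<lfloor>x / (2 * pi)\<rfloor> * (2 * pi) \<le> x" "x < (of_int \<lfloor>x / (2 * pi)\<rfloor> + 1) * (2 * pi)"
    by (simp_all only: pos_le_divide_eq pos_divide_less_eq pi_gt_zero zero_less_mult_iff zero_less_numeral simp_thms)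
  then show ?thesis by (simp add: algebra_simps)
qed

lemma periodic_ext_eq:
  assumes "x - 2 * pi * of_int j \<in> {0..<2 * pi}"
  shows "periodic_ext h x = h (x - 2 * pi * of_int j)"
proof -
  have "\<lfloor>x / (2 * pi)\<rfloor> = j"
    using assms by (intro floor_unique) (simp_all add: field_simps)
  then show ?thesis by (simp add: periodic_ext_def)
qed

lemma periodic_ext_id: "x \<in> {0..<2 * pi} \<Longrightarrow> periodic_ext h x = h x"
  using periodic_ext_eq[of x 0 h] by simp

lemma periodic_ext_shift: "periodic_ext h (x + 2 * pi * of_int j) = periodic_ext h x"
proof -
  have "(x + 2 * pi * of_int j) / (2 * pi) = x / (2 * pi) + of_int j" by (simp add: field_simps)
  then show ?thesis by (simp add: periodic_ext_def algebra_simps)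
qed

lemma exp_periodic_int: "exp (\<i> * of_int k * of_real (x + 2 * pi * of_int j)) = exp (\<i> * of_int k * of_real x)"
  by (simp add: exp_eq) (rule exI[of _ "k * j"], simp add: algebra_simps)

lemma fourier_sum_shift: "fourier_sum h n (x + 2 * pi * of_int j) = fourier_sum h n x"
  unfolding fourier_sum_def exp_periodic_int ..

lemma fourier_regular_cong:
  assumes "fourier_regular h" and eq: "\<And>x. x \<in> {0..2 * pi} \<Longrightarrow> h x = h' x"
  shows "fourier_regular h'"
proof -
  have "periodic_ext h = periodic_ext h'"
    unfolding periodic_ext_def using periodic_ext_range by (intro ext eq) fastforce
  moreover have "fourier_coeff h = fourier_coeff h'"
    unfolding fourier_coeff_def by (intro ext arg_cong2[where f="(*)"] refl integral_cong) (simp add: eq)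
  then have "fourier_sum h = fourier_sum h'"
    by (intro ext) (simp add: fourier_sum_def)
  moreover have "h ` {0..2 * pi} = h' ` {0..2 * pi}"
    using eq by (intro image_cong) auto
  moreover have "(\<lambda>x. h x * \<phi> x) integrable_on {0..2 * pi} \<longleftrightarrow> (\<lambda>x. h' x * \<phi> x) integrable_on {0..2 * pi}" for \<phi>
    using eq by (intro integrable_cong) auto
  ultimately show ?thesis using assms(1) unfolding fourier_regular_def by simp
qed

lemma fourier_regular_add:
  assumes "fourier_regular f" "fourier_regular g"
  shows "fourier_regular (\<lambda>x. f x + g x)"
  unfolding fourier_regular_def
proof (intro conjI allI impI)
  have ext: "periodic_ext (\<lambda>x. f x + g x) = (\<lambda>x. periodic_ext f x + periodic_ext g x)"
    by (simp add: periodic_ext_def fun_eq_iff)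
  note int = fourier_regular_integrable[OF assms(1)] fourier_regular_integrable[OF assms(2)]
  show "(\<lambda>x. (f x + g x) * \<phi> x) integrable_on {0..2 * pi}" if "continuous_on {0..2 * pi} \<phi>" for \<phi>
    unfolding distrib_right by (intro integrable_add int that)
  show "bounded ((\<lambda>x. f x + g x) ` {0..2 * pi})"
    using assms by (intro bounded_plus_comp) (auto simp: fourier_regular_bounded)
  show "countable {x. \<not> isCont (periodic_ext (\<lambda>x. f x + g x)) x}"
    by (rule countable_subset[of _ "{x. \<not> isCont (periodic_ext f) x} \<union> {x. \<not> isCont (periodic_ext g) x}"])
       (auto simp: ext fourier_regular_countable assms)
  have coeff: "fourier_coeff (\<lambda>x. f x + g x) k = fourier_coeff f k + fourier_coeff g k" for k
    unfolding fourier_coeff_def distrib_right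
    by (subst integral_add) (auto intro!: int continuous_intros simp: distrib_left)
  fix x
  obtain l r where 1: "(periodic_ext f \<longlongrightarrow> l) (at_left x)" "(periodic_ext f \<longlongrightarrow> r) (at_right x)"
      "(\<lambda>n. fourier_sum f n x) \<longlonglongrightarrow> (l + r) / 2"
    using assms(1) unfolding fourier_regular_def by blast
  obtain l' r' where 2: "(periodic_ext g \<longlongrightarrow> l') (at_left x)" "(periodic_ext g \<longlongrightarrow> r') (at_right x)"
      "(\<lambda>n. fourier_sum g n x) \<longlonglongrightarrow> (l' + r') / 2"
    using assms(2) unfolding fourier_regular_def by blast
  have "fourier_sum (\<lambda>x. f x + g x) n x = fourier_sum f n x + fourier_sum g n x" for n
    by (simp add: fourier_sum_def coeff distrib_right sum.distrib)
  then have "(\<lambda>n. fourier_sum (\<lambda>x. f x + g x) n x) \<longlonglongrightarrow> (l + l' + (r + r')) / 2"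
    using tendsto_add[OF 1(3) 2(3)] by (simp add: add_divide_distrib add_ac)
  moreover have "(periodic_ext (\<lambda>x. f x + g x) \<longlongrightarrow> l + l') (at_left x)"
    "(periodic_ext (\<lambda>x. f x + g x) \<longlongrightarrow> r + r') (at_right x)"
    unfolding ext using 1 2 by (auto intro: tendsto_add)
  ultimately show "\<exists>l r. (periodic_ext (\<lambda>x. f x + g x) \<longlongrightarrow> l) (at_left x)
      \<and> (periodic_ext (\<lambda>x. f x + g x) \<longlongrightarrow> r) (at_right x)
      \<and> (\<lambda>n. fourier_sum (\<lambda>x. f x + g x) n x) \<longlonglongrightarrow> (l + r) / 2"
    by blast
qed

lemma fourier_coeff_cmult: "fourier_coeff (\<lambda>x. c * f x) k = c * fourier_coeff f k"
  by (simp add: fourier_coeff_def mult.assoc)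

lemma fourier_regular_cmult:
  assumes "fourier_regular f"
  shows "fourier_regular (\<lambda>x. c * f x)"
  unfolding fourier_regular_def
proof (intro conjI allI impI)
  have ext: "periodic_ext (\<lambda>x. c * f x) = (\<lambda>x. c * periodic_ext f x)"
    by (simp add: periodic_ext_def fun_eq_iff)
  note int = fourier_regular_integrable[OF assms]
  show "(\<lambda>x. (c * f x) * \<phi> x) integrable_on {0..2 * pi}" if "continuous_on {0..2 * pi} \<phi>" for \<phi>
    unfolding mult.assoc by (intro integrable_on_mult_right int that)
  show "bounded ((\<lambda>x. c * f x) ` {0..2 * pi})"
    using bounded_linear_image[OF fourier_regular_bounded[OF assms] bounded_linear_mult_right[of c]]
    by (simp add: image_image)
  show "countable {x. \<not> isCont (periodic_ext (\<lambda>x. c * f x)) x}"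
    by (rule countable_subset[of _ "{x. \<not> isCont (periodic_ext f) x}"])
       (auto simp: ext fourier_regular_countable assms)
  fix x
  obtain l r where 1: "(periodic_ext f \<longlongrightarrow> l) (at_left x)" "(periodic_ext f \<longlongrightarrow> r) (at_right x)"
      "(\<lambda>n. fourier_sum f n x) \<longlonglongrightarrow> (l + r) / 2"
    using assms(1) unfolding fourier_regular_def by blast
  have "fourier_sum (\<lambda>x. c * f x) n x = c * fourier_sum f n x" for n
    by (simp add: fourier_sum_def fourier_coeff_cmult sum_distrib_left mult.assoc)
  then have "(\<lambda>n. fourier_sum (\<lambda>x. c * f x) n x) \<longlonglongrightarrow> (c * l + c * r) / 2"
    using tendsto_mult_left[OF 1(3), of c] by (simp add: algebra_simps)
  moreover have "(periodic_ext (\<lambda>x. c * f x) \<longlongrightarrow> c * l) (at_left x)"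
    "(periodic_ext (\<lambda>x. c * f x) \<longlongrightarrow> c * r) (at_right x)"
    unfolding ext using 1 by (auto intro: tendsto_mult_left)
  ultimately show "\<exists>l r. (periodic_ext (\<lambda>x. c * f x) \<longlongrightarrow> l) (at_left x)
      \<and> (periodic_ext (\<lambda>x. c * f x) \<longlongrightarrow> r) (at_right x)
      \<and> (\<lambda>n. fourier_sum (\<lambda>x. c * f x) n x) \<longlonglongrightarrow> (l + r) / 2"
    by blast
qed

lemma fourier_regular_diff:
  assumes "fourier_regular f" "fourier_regular g"
  shows "fourier_regular (\<lambda>x. f x - g x)"
  using fourier_regular_add[OF assms(1) fourier_regular_cmult[OF assms(2), of "-1"]] by simp

text \<open>Assumes just the integrability clause of \<open>fourier_regular\<close>, because it
  serves to establish the convergence clause for monotone functions.\<close>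

lemma fourier_sum_dirichlet:
  assumes "\<And>\<phi>. continuous_on {0..2 * pi} \<phi> \<Longrightarrow> (\<lambda>x. h x * \<phi> x) integrable_on {0..2 * pi}"
  shows "fourier_sum h n x =
    1 / (2 * of_real pi) * integral {0..2 * pi} (\<lambda>y. h y * of_real (dirichlet_kernel n (y - x)))"
proof -
  have "of_real (dirichlet_kernel n (y - x)) =
      (\<Sum>k\<in>{- int n..int n}. exp (- \<i> * of_int k * of_real y) * exp (\<i> * of_int k * of_real x))" for y
  proof -
    have "exp (\<i> * of_int k * of_real (- (y - x))) =
        exp (- \<i> * of_int k * of_real y) * exp (\<i> * of_int k * of_real x)" for k
      by (simp add: algebra_simps flip: exp_add)
    then show ?thesis
      unfolding dirichlet_kernel_minus[of n "y - x", symmetric] exp_sum_dirichlet_kernel[symmetric]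
      by simp
  qed
  then have "integral {0..2 * pi} (\<lambda>y. h y * of_real (dirichlet_kernel n (y - x)))
     = integral {0..2 * pi} (\<lambda>y. \<Sum>k\<in>{- int n..int n}.
         h y * exp (- \<i> * of_int k * of_real y) * exp (\<i> * of_int k * of_real x))"
    by (simp add: sum_distrib_left mult.assoc)
  also have "\<dots> = (\<Sum>k\<in>{- int n..int n}. integral {0..2 * pi} (\<lambda>y.
         h y * exp (- \<i> * of_int k * of_real y) * exp (\<i> * of_int k * of_real x)))"
    by (intro integral_sum integrable_on_mult_left assms continuous_intros) auto
  also have "\<dots> = (\<Sum>k\<in>{- int n..int n}. integral {0..2 * pi} (\<lambda>y.
         h y * exp (- \<i> * of_int k * of_real y)) * exp (\<i> * of_int k * of_real x))"
    by (simp only: integral_mult_left)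
  finally show ?thesis
    by (simp add: fourier_sum_def fourier_coeff_def sum_distrib_left mult.assoc)
qed

text \<open>For 0 < x < 2\<pi> the Dirichlet integral splits at x, and each half tends to \<pi>
  times the limit on its side; division by 2\<pi> gives the mean. Every other x is moved into [0,
  2\<pi>) by whole periods.\<close>

lemma fourier_regular_mono:
  fixes m :: "real \<Rightarrow> real"
  assumes m: "mono m"
  shows "fourier_regular (\<lambda>x. of_real (m x))" (is "fourier_regular ?h")
  unfolding fourier_regular_def
proof (intro conjI allI)
  have int: "(\<lambda>x. ?h x * \<phi> x) integrable_on {0..2 * pi}" if "continuous_on {0..2 * pi} \<phi>" for \<phi>
  proof -
    have "(\<lambda>x. ?h x * \<phi> x) = (\<lambda>x. of_real (m x * Re (\<phi> x)) + \<i> * of_real (m x * Im (\<phi> x)))"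
      by (simp add: fun_eq_iff complex_eq_iff)
    moreover have "(\<lambda>x. of_real (m x * Re (\<phi> x)) + \<i> * of_real (m x * Im (\<phi> x))) integrable_on {0..2 * pi}"
      by (intro integrable_add integrable_on_mult_right
            integrable_linear[OF _ bounded_linear_of_real, unfolded o_def]
            mono_times_integrable[OF m] integrable_continuous_real continuous_on_Re continuous_on_Im that)
    ultimately show ?thesis by simp
  qed
  then show "continuous_on {0..2 * pi} \<phi> \<longrightarrow> (\<lambda>x. ?h x * \<phi> x) integrable_on {0..2 * pi}" for \<phi>
    by blast
  have "norm (?h x) \<le> \<bar>m 0\<bar> + \<bar>m (2 * pi)\<bar>" if "x \<in> {0..2 * pi}" for x
    using monoD[OF m, of 0 x] monoD[OF m, of x "2 * pi"] that by auto
  then show "bounded (?h ` {0..2 * pi})"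
    unfolding bounded_iff by blast
  have near: "\<forall>\<^sub>F z in nhds x. periodic_ext ?h z = of_real (m (z - 2 * pi * of_int j))"
    if "x - 2 * pi * of_int j \<in> {0<..<2 * pi}" for x j
  proof (rule eventually_nhds_in_open[THEN eventually_mono])
    show "open {2 * pi * of_int j<..<2 * pi + 2 * pi * of_int j}" by simp
    show "x \<in> {2 * pi * of_int j<..<2 * pi + 2 * pi * of_int j}" using that by auto
    show "periodic_ext ?h z = of_real (m (z - 2 * pi * of_int j))"
      if "z \<in> {2 * pi * of_int j<..<2 * pi + 2 * pi * of_int j}" for z
      using that by (intro periodic_ext_eq) auto
  qed
  show "countable {x. \<not> isCont (periodic_ext ?h) x}"
  proof (rule countable_subset)
    \<comment> \<open>The extension can break only at translated discontinuities of m and at the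
      seams, the multiples of 2\<pi>; the inserted 0 stands for the seams.\<close>
    show "{x. \<not> isCont (periodic_ext ?h) x} \<subseteq>
      (\<Union>j::int. (\<lambda>z. z + 2 * pi * of_int j) ` insert 0 {z. \<not> isCont m z})"
    proof
      fix x assume x: "x \<in> {x. \<not> isCont (periodic_ext ?h) x}"
      define j where "j = \<lfloor>x / (2 * pi)\<rfloor>"
      define z where "z = x - 2 * pi * of_int j"
      have z: "z \<in> {0..<2 * pi}" using periodic_ext_range[of x] by (simp add: z_def j_def)
      have "z \<in> insert 0 {z. \<not> isCont m z}"
      proof (rule ccontr)
        assume "z \<notin> insert 0 {z. \<not> isCont m z}"
        then have "z \<in> {0<..<2 * pi}" "isCont m z" using z by auto
        then have "isCont (\<lambda>y. of_real (m (y - 2 * pi * of_int j)) :: complex) x"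
          unfolding z_def by (intro continuous_of_real isCont_o2[where f = "\<lambda>y. y - 2 * pi * of_int j" and g = m]) simp_all
        moreover have "isCont (periodic_ext ?h) x \<longleftrightarrow> isCont (\<lambda>y. of_real (m (y - 2 * pi * of_int j)) :: complex) x"
          using near[of x j] \<open>z \<in> {0<..<2 * pi}\<close> by (intro isCont_cong) (auto simp: z_def)
        ultimately show False using x by simp
      qed
      moreover have "x = z + 2 * pi * of_int j" by (simp add: z_def)
      ultimately show "x \<in> (\<Union>j::int. (\<lambda>z. z + 2 * pi * of_int j) ` insert 0 {z. \<not> isCont m z})"
        by blast
    qed
    show "countable (\<Union>j::int. (\<lambda>z. z + 2 * pi * of_int j) ` insert 0 {z. \<not> isCont m z})"
      using mono_ctble_discont[OF m] by (intro countable_UN countable_image) auto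
  qed
  have base: "\<exists>l r. (periodic_ext ?h \<longlongrightarrow> l) (at_left x) \<and> (periodic_ext ?h \<longlongrightarrow> r) (at_right x)
        \<and> (\<lambda>n. fourier_sum ?h n x) \<longlonglongrightarrow> (l + r) / 2" if x: "x \<in> {0..<2 * pi}" for x
  proof -
    define I where "I n u v = integral {u..v} (\<lambda>y. m y * dirichlet_kernel n (y - x))" for n u v
    have D: "(\<lambda>y. m y * dirichlet_kernel n (y - x)) integrable_on {u..v}" for n u v
      by (intro mono_times_integrable[OF m] integrable_continuous_real
            continuous_on_compose2[OF continuous_on_dirichlet_kernel[of UNIV]] continuous_intros) auto
    have S: "fourier_sum ?h n x = of_real (I n 0 (2 * pi)) / (2 * of_real pi)" for n
    proof -
      have "integral {0..2 * pi} (\<lambda>y. ?h y * of_real (dirichlet_kernel n (y - x))) = of_real (I n 0 (2 * pi))"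
        using integral_linear[OF D bounded_linear_of_real, of 0 "2 * pi" n] by (simp add: I_def o_def)
      then show ?thesis by (simp add: fourier_sum_dirichlet[OF int])
    qed
    obtain l r :: real where lr: "(periodic_ext ?h \<longlongrightarrow> of_real l) (at_left x)"
        "(periodic_ext ?h \<longlongrightarrow> of_real r) (at_right x)" "(\<lambda>n. I n 0 (2 * pi)) \<longlonglongrightarrow> pi * l + pi * r"
    proof (cases "x = 0")
      case False
      then have x: "0 < x" "x < 2 * pi" using x by auto
      obtain l r where l: "(m \<longlongrightarrow> l) (at_left x)" and r: "(m \<longlongrightarrow> r) (at_right x)"
        using mono_limit_left[OF m] mono_limit_right[OF m] by metis
      have ev: "\<forall>\<^sub>F z in nhds x. of_real (m z) = periodic_ext ?h z"
        using near[of x 0] x by (auto elim: eventually_mono)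
      have "(periodic_ext ?h \<longlongrightarrow> of_real l) (at_left x)"
        by (rule Lim_transform_eventually[OF tendsto_of_real[OF l]])
           (use ev in \<open>auto simp: eventually_at_filter elim: eventually_mono\<close>)
      moreover have "(periodic_ext ?h \<longlongrightarrow> of_real r) (at_right x)"
        by (rule Lim_transform_eventually[OF tendsto_of_real[OF r]])
           (use ev in \<open>auto simp: eventually_at_filter elim: eventually_mono\<close>)
      moreover have "(\<lambda>n. I n (x - x) x + I n x (x + (2 * pi - x))) \<longlonglongrightarrow> pi * l + pi * r"
        unfolding I_def using x by (intro tendsto_add dirichlet_limit_left dirichlet_limit_right m l r) auto
      moreover have "I n (x - x) x + I n x (x + (2 * pi - x)) = I n 0 (2 * pi)" for n
        unfolding I_def using x by (simp add: Henstock_Kurzweil_Integration.integral_combine[OF _ _ D])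
      ultimately show thesis using that by simp
    next
      \<comment> \<open>Just left of the seam 0 the extension shows m near 2\<pi>. The period is cut
        at \<pi>, and periodicity of the kernel recentres the half [\<pi>, 2\<pi>] at 2\<pi>, where
        it acts as the left half.\<close>
      case True
      obtain l r where l: "(m \<longlongrightarrow> l) (at_left (2 * pi))" and r: "(m \<longlongrightarrow> r) (at_right 0)"
        using mono_limit_left[OF m] mono_limit_right[OF m] by metis
      have "(periodic_ext ?h \<longlongrightarrow> of_real r) (at_right 0)"
      proof (rule Lim_transform_eventually[OF tendsto_of_real[OF r]])
        show "\<forall>\<^sub>F z in at_right 0. of_real (m z) = periodic_ext ?h z"
          unfolding eventually_at_right[OF zero_less_one]
          using pi_gt_zero by (intro exI[of _ pi]) (auto simp: periodic_ext_id)
      qed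
      moreover have "(periodic_ext ?h \<longlongrightarrow> of_real l) (at_left 0)"
      proof (rule Lim_transform_eventually)
        have "filterlim (\<lambda>z. z + 2 * pi) (at_left (2 * pi)) (at_left 0)"
        proof (rule filterlim_at_withinI)
          show "((\<lambda>z. z + 2 * pi) \<longlongrightarrow> 2 * pi) (at_left 0)"
            by (rule tendsto_eq_intros refl)+ simp
          show "\<forall>\<^sub>F z in at_left 0. z + 2 * pi \<in> {..<2 * pi} - {2 * pi}"
            by (simp add: eventually_at_filter)
        qed
        then show "((\<lambda>z. complex_of_real (m (z + 2 * pi))) \<longlongrightarrow> of_real l) (at_left 0)"
          by (intro tendsto_of_real filterlim_compose[OF l])
        have "of_real (m (z + 2 * pi)) = periodic_ext ?h z" if "- pi < z" "z < 0" for z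
          using that periodic_ext_eq[of z "-1" ?h] by simp
        then show "\<forall>\<^sub>F z in at_left 0. of_real (m (z + 2 * pi)) = periodic_ext ?h z"
          using eventually_at_left[of "- pi" 0] by (auto intro!: exI[of _ "- pi"])
      qed
      moreover have "(\<lambda>n. integral {2 * pi - pi..2 * pi} (\<lambda>y. m y * dirichlet_kernel n (y - 2 * pi))
          + integral {0..0 + pi} (\<lambda>y. m y * dirichlet_kernel n (y - 0))) \<longlonglongrightarrow> pi * l + pi * r"
        by (intro tendsto_add dirichlet_limit_left dirichlet_limit_right m l r) auto
      moreover have "integral {2 * pi - pi..2 * pi} (\<lambda>y. m y * dirichlet_kernel n (y - 2 * pi))
          + integral {0..0 + pi} (\<lambda>y. m y * dirichlet_kernel n (y - 0)) = I n 0 (2 * pi)" for n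
        unfolding I_def True dirichlet_kernel_periodic
        using Henstock_Kurzweil_Integration.integral_combine[OF _ _ D[of n 0 "2 * pi", unfolded True], of pi] by simp
      ultimately show thesis using that True by simp
    qed
    have lim: "(\<lambda>n. of_real (I n 0 (2 * pi)) / (2 * of_real pi) :: complex)
        \<longlonglongrightarrow> of_real (pi * l + pi * r) / (2 * of_real pi)"
      by (intro tendsto_intros lr(3)) auto
    then have "(\<lambda>n. fourier_sum ?h n x) \<longlonglongrightarrow> (of_real l + of_real r) / 2"
    proof -
      have "of_real (pi * l + pi * r) / (2 * of_real pi) = (of_real l + of_real r) / (2 :: complex)"
        by (simp add: field_simps)
      then show ?thesis using lim unfolding S by (simp only:)
    qed
    then show ?thesis using lr by blast
  qed
  fix x
  define j where "j = \<lfloor>x / (2 * pi)\<rfloor>"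
  define z where "z = x - 2 * pi * of_int j"
  have z: "z \<in> {0..<2 * pi}" using periodic_ext_range[of x] by (simp add: z_def j_def)
  have x: "x = z + 2 * pi * of_int j" by (simp add: z_def)
  obtain l r where lr: "(periodic_ext ?h \<longlongrightarrow> l) (at_left z)" "(periodic_ext ?h \<longlongrightarrow> r) (at_right z)"
      "(\<lambda>n. fourier_sum ?h n z) \<longlonglongrightarrow> (l + r) / 2"
    using base[OF z] by blast
  have lim: "((\<lambda>y. y - 2 * pi * of_int j) \<longlongrightarrow> z) (at x within A)" for A
    unfolding z_def by (intro tendsto_intros)
  have shift: "periodic_ext ?h (y - 2 * pi * of_int j) = periodic_ext ?h y" for y
    using periodic_ext_shift[of ?h "y - 2 * pi * of_int j" j] by simp
  have "filterlim (\<lambda>y. y - 2 * pi * of_int j) (at_left z) (at_left x)"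
    by (rule filterlim_at_withinI[OF lim]) (auto simp: eventually_at_filter z_def)
  from filterlim_compose[OF lr(1) this] have "(periodic_ext ?h \<longlongrightarrow> l) (at_left x)"
    by (simp only: shift)
  moreover have "filterlim (\<lambda>y. y - 2 * pi * of_int j) (at_right z) (at_right x)"
    by (rule filterlim_at_withinI[OF lim]) (auto simp: eventually_at_filter z_def)
  from filterlim_compose[OF lr(2) this] have "(periodic_ext ?h \<longlongrightarrow> r) (at_right x)"
    by (simp only: shift)
  moreover have "(\<lambda>n. fourier_sum ?h n x) \<longlonglongrightarrow> (l + r) / 2"
    unfolding x fourier_sum_shift by (rule lr)
  ultimately show "\<exists>l r. (periodic_ext ?h \<longlongrightarrow> l) (at_left x) \<and> (periodic_ext ?h \<longlongrightarrow> r) (at_right x)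
        \<and> (\<lambda>n. fourier_sum ?h n x) \<longlonglongrightarrow> (l + r) / 2"
    by blast
qed

section \<open>From monotone functions to bounded variation\<close>

lemma fourier_regular_mono_on:
  fixes m :: "real \<Rightarrow> real"
  assumes "mono_on {0..2 * pi} m"
  shows "fourier_regular (\<lambda>x. of_real (m x))"
proof -
  \<comment> \<open>Clamping the argument to the interval extends m monotonically to the whole
    line.\<close>
  have "mono (\<lambda>x. m (max 0 (min x (2 * pi))))"
    using assms by (auto simp: mono_def mono_on_def)
  from fourier_regular_cong[OF fourier_regular_mono[OF this]] show ?thesis by simp
qed

text \<open>V is the variation function. This one inequality is the useful form because V, V + Re h
  and V + Im h are all nondecreasing by it.\<close>

lemma bounded_variation_dominating_mono:
  assumes "has_bounded_variation_on h a b"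
  obtains V :: "real \<Rightarrow> real" where
    "\<And>x y. a \<le> x \<Longrightarrow> x \<le> y \<Longrightarrow> y \<le> b \<Longrightarrow> V x + norm (h y - h x) \<le> V y"
proof -
  obtain M where M: "\<And>(n::nat) s. (\<forall>i\<le>n. s i \<in> {a..b}) \<Longrightarrow> (\<forall>i<n. s i \<le> s (Suc i)) \<Longrightarrow>
      (\<Sum>i<n. norm (h (s (Suc i)) - h (s i))) \<le> M"
    using assms unfolding has_bounded_variation_on_def by blast
  define S where "S x = {w. \<exists>(n::nat) s. (\<forall>i\<le>n. s i \<in> {a..x}) \<and> (\<forall>i<n. s i \<le> s (Suc i)) \<and>
      w = (\<Sum>i<n. norm (h (s (Suc i)) - h (s i)))}" for x
  have "Sup (S x) + norm (h y - h x) \<le> Sup (S y)" if xy: "a \<le> x" "x \<le> y" "y \<le> b" for x y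
  proof -
    have "Sup (S x) \<le> Sup (S y) - norm (h y - h x)"
    proof (rule cSup_least)
      show "S x \<noteq> {}"
        using xy by (auto simp: S_def intro!: exI[of _ "0::nat"] exI[of _ "\<lambda>_. a"])
      fix w assume "w \<in> S x"
      then obtain n s where s: "\<forall>i\<le>n. s i \<in> {a..x}" "\<forall>i<n. s i \<le> s (Suc i)"
          "w = (\<Sum>i<n. norm (h (s (Suc i)) - h (s i)))"
        unfolding S_def by blast
      \<comment> \<open>The partition of [a, x] is prolonged by x and then by y. It may stop short
        of x, so two points are added; the first new term is nonnegative and dropped, the second is
        the increment to be gained.\<close>
      define s' where "s' i = (if i \<le> n then s i else if i = Suc n then x else y)" for i
      have s': "\<forall>i\<le>Suc (Suc n). s' i \<in> {a..y}" "\<forall>i<Suc (Suc n). s' i \<le> s' (Suc i)"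
        using s xy by (fastforce simp: s'_def less_Suc_eq)+
      have "bdd_above (S y)"
      proof (rule bdd_aboveI)
        fix w assume "w \<in> S y"
        then obtain n s where s: "\<forall>i\<le>n. s i \<in> {a..y}" "\<forall>i<n. s i \<le> s (Suc i)"
            "w = (\<Sum>i<n. norm (h (s (Suc i)) - h (s i)))"
          unfolding S_def by blast
        have "\<forall>i\<le>n. s i \<in> {a..b}" using s(1) xy(3) by fastforce
        then show "w \<le> M" using M s by blast
      qed
      moreover have "(\<Sum>i<Suc (Suc n). norm (h (s' (Suc i)) - h (s' i))) \<in> S y"
        unfolding S_def using s' by blast
      ultimately have "(\<Sum>i<Suc (Suc n). norm (h (s' (Suc i)) - h (s' i))) \<le> Sup (S y)"
        by (rule cSup_upper[rotated])
      moreover have "(\<Sum>i<Suc (Suc n). norm (h (s' (Suc i)) - h (s' i))) =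
          w + norm (h x - h (s n)) + norm (h y - h x)"
        by (simp add: s'_def s(3))
      ultimately show "w \<le> Sup (S y) - norm (h y - h x)"
        using norm_ge_zero[of "h x - h (s n)"] by linarith
    qed
    then show ?thesis by simp
  qed
  then show thesis by (rule that[of "\<lambda>x. Sup (S x)"])
qed

text \<open>Jordan decomposition with a common V: Re h and Im h are each a monotone function minus
  V, since the real and imaginary parts of an increment are bounded by its norm.\<close>

lemma fourier_regular_bounded_variation:
  assumes "has_bounded_variation_on h 0 (2 * pi)"
  shows "fourier_regular h"
proof -
  obtain V where V: "\<And>x y. 0 \<le> x \<Longrightarrow> x \<le> y \<Longrightarrow> y \<le> 2 * pi \<Longrightarrow> V x + norm (h y - h x) \<le> V y"
    using bounded_variation_dominating_mono[OF assms] by blast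
  have mono: "mono_on {0..2 * pi} V"
  proof (rule mono_onI)
    fix x y assume "x \<in> {0..2 * pi}" "y \<in> {0..2 * pi}" "x \<le> y"
    then have "V x + norm (h y - h x) \<le> V y" by (intro V) auto
    then show "V x \<le> V y" using norm_ge_zero[of "h y - h x"] by linarith
  qed
  have "mono_on {0..2 * pi} (\<lambda>x. V x + Re (h x))"
  proof (rule mono_onI)
    fix x y assume "x \<in> {0..2 * pi}" "y \<in> {0..2 * pi}" "x \<le> y"
    then show "V x + Re (h x) \<le> V y + Re (h y)"
      using V[of x y] abs_Re_le_cmod[of "h y - h x"] by auto
  qed
  moreover have "mono_on {0..2 * pi} (\<lambda>x. V x + Im (h x))"
  proof (rule mono_onI)
    fix x y assume "x \<in> {0..2 * pi}" "y \<in> {0..2 * pi}" "x \<le> y"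
    then show "V x + Im (h x) \<le> V y + Im (h y)"
      using V[of x y] abs_Im_le_cmod[of "h y - h x"] by auto
  qed
  ultimately have "fourier_regular (\<lambda>x. (of_real (V x + Re (h x)) - of_real (V x))
      + \<i> * (of_real (V x + Im (h x)) - of_real (V x)))"
    by (intro fourier_regular_add fourier_regular_diff fourier_regular_cmult fourier_regular_mono_on mono)
  then show ?thesis by (rule fourier_regular_cong) (simp add: complex_eq_iff)
qed

lemma fourier_regular_const: "fourier_regular (\<lambda>x. c)"
proof -
  have "fourier_regular (\<lambda>x. of_real 1)"
    by (rule fourier_regular_mono) (simp add: mono_def)
  from fourier_regular_cmult[OF this, of c] show ?thesis by simp
qed

lemma fourier_regular_sum:
  assumes "\<And>l. l \<in> A \<Longrightarrow> fourier_regular (f l)"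
  shows "fourier_regular (\<lambda>x. \<Sum>l\<in>A. f l x)"
  using assms by (induction A rule: infinite_finite_induct)
    (auto intro!: fourier_regular_const fourier_regular_add)

lemma fourier_regular_integrable_exp:
  assumes "fourier_regular h"
  shows "(\<lambda>x. h x * exp (- \<i> * of_int k * of_real x)) integrable_on {0..2 * pi}"
  by (intro fourier_regular_integrable assms continuous_intros)

lemma fourier_coeff_diff:
  assumes "fourier_regular f" "fourier_regular g"
  shows "fourier_coeff (\<lambda>x. f x - g x) k = fourier_coeff f k - fourier_coeff g k"
  unfolding fourier_coeff_def left_diff_distrib
    integral_diff[OF fourier_regular_integrable_exp[OF assms(1)] fourier_regular_integrable_exp[OF assms(2)]]
  by (rule right_diff_distrib)

lemma fourier_coeff_sum:
  assumes "finite A" "\<And>l. l \<in> A \<Longrightarrow> fourier_regular (f l)"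
  shows "fourier_coeff (\<lambda>x. \<Sum>l\<in>A. f l x) k = (\<Sum>l\<in>A. fourier_coeff (f l) k)"
proof -
  have "integral {0..2 * pi} (\<lambda>x. \<Sum>l\<in>A. f l x * exp (- \<i> * of_int k * of_real x))
      = (\<Sum>l\<in>A. integral {0..2 * pi} (\<lambda>x. f l x * exp (- \<i> * of_int k * of_real x)))"
    by (intro integral_sum assms fourier_regular_integrable_exp)
  then show ?thesis unfolding fourier_coeff_def sum_distrib_right by (simp only: sum_distrib_left)
qed

lemma fourier_regular_power: "fourier_regular (\<lambda>x. of_real x ^ N)"
  using fourier_regular_mono_on[of "\<lambda>x. x ^ N"] by (simp add: mono_on_def power_mono)

subsection \<open>Fourier coefficients of \<open>Q\<^sub>N\<close>\<close>

text \<open>The constants of the recursion, indexed by m = N - l, with the sign powers collected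
  into \<i>^m. Their generating function is (exp (2\<pi>\<i>z) - 1) / (2\<pi>\<i>z). As the value at
  m = 0 is 1, the recursion says that the sum of c_(N-l) Q_l over 1 \<le> l \<le> N is -\<i>^N x^N /
  N!.\<close>

definition Q_recurrence_coeff :: "nat \<Rightarrow> complex"
  where "Q_recurrence_coeff m = \<i> ^ m * of_real (2 * pi) ^ m / fact (m + 1)"

lemma Q_poly_eq:
  assumes "N \<ge> 1"
  shows "Q_poly N x = - (\<i> ^ N / fact N) * of_real x ^ N
    - (\<Sum>l\<in>{1..<N}. Q_recurrence_coeff (N - l) * Q_poly l x)"
proof -
  have "(- 1) powi (int l - int N) / (- \<i>) powi (int l - int N)
          * (of_real (2 * pi) ^ (N - l) / fact (N - l + 1)) = Q_recurrence_coeff (N - l)"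
    if "l \<in> {1..<N}" for l
  proof -
    define m where "m = N - l"
    have "int l - int N = - int m" using that by (simp add: m_def)
    then have "(- 1) powi (int l - int N) / (- \<i>) powi (int l - int N) = ((- \<i>) / (- 1)) ^ m"
      unfolding power_divide by (simp only: power_int_minus power_int_of_nat) (simp add: field_simps)
    then show ?thesis by (simp add: Q_recurrence_coeff_def m_def)
  qed
  moreover have "(- \<i>) ^ N * of_real x ^ N / ((- 1) ^ (N - 1) * fact N) = - (\<i> ^ N / fact N) * of_real x ^ N"
  proof -
    obtain M where "N = Suc M" using assms by (cases N) auto
    then show ?thesis unfolding power_minus[of \<i> N] by (simp add: field_simps del: fact_Suc)
  qed
  moreover note Q_poly.simps[of N x]
  ultimately show ?thesis
    by (simp only: cong: sum.cong)
qed

lemma fourier_regular_Q_poly: "fourier_regular (Q_poly N)"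
  and continuous_on_Q_poly: "continuous_on A (Q_poly N)"
proof (induction N rule: less_induct)
  case (less N)
  define c where "c = (- \<i>) ^ N / ((- 1) ^ (N - 1) * fact N)"
  define d where "d l = (- 1) powi (int l - int N) / (- \<i>) powi (int l - int N)
          * (of_real (2 * pi) ^ (N - l) / fact (N - l + 1))" for l
  have Q: "Q_poly N = (\<lambda>x. c * of_real x ^ N - (\<Sum>l\<in>{1..<N}. d l * Q_poly l x))"
    by (subst fun_eq_iff, subst Q_poly.simps) (simp add: c_def d_def)
  show "fourier_regular (Q_poly N)"
    unfolding Q by (intro fourier_regular_diff fourier_regular_cmult fourier_regular_sum
        fourier_regular_power less(1)) auto
  show "continuous_on A (Q_poly N)"
    unfolding Q by (intro continuous_intros less(2)) auto
qed

text \<open>Integration by parts, kept free of division by k: the boundary term of x^(N+1) exp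
  (-\<i>kx) vanishes at 0, and at 2\<pi> the exponential is 1.\<close>

lemma fourier_coeff_power_Suc:
  "of_nat (Suc N) * fourier_coeff (\<lambda>x. of_real x ^ N) k
     - \<i> * of_int k * fourier_coeff (\<lambda>x. of_real x ^ Suc N) k = of_real (2 * pi) ^ N"
proof -
  define E where "E x = exp (- \<i> * of_int k * of_real x)" for x
  have "((\<lambda>x. of_nat (Suc N) * (of_real x ^ N * E x) - \<i> * of_int k * (of_real x ^ Suc N * E x))
      has_integral of_real (2 * pi) ^ Suc N * E (2 * pi) - of_real 0 ^ Suc N * E 0) {0..2 * pi}"
  proof (rule fundamental_theorem_of_calculus)
    fix x :: real
    have "((\<lambda>z. z ^ Suc N * exp (- \<i> * of_int k * z)) has_field_derivative
       of_nat (Suc N) * (of_real x ^ N * E x) - \<i> * of_int k * (of_real x ^ Suc N * E x)) (at (of_real x))"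
      by (auto intro!: derivative_eq_intros simp: E_def algebra_simps simp del: power_Suc)
    from has_vector_derivative_real_field[OF this]
    show "((\<lambda>x. of_real x ^ Suc N * E x) has_vector_derivative
       of_nat (Suc N) * (of_real x ^ N * E x) - \<i> * of_int k * (of_real x ^ Suc N * E x))
       (at x within {0..2 * pi})"
      unfolding E_def by (rule has_vector_derivative_at_within)
  qed simp
  moreover have "((\<lambda>x. of_nat (Suc N) * (of_real x ^ N * E x) - \<i> * of_int k * (of_real x ^ Suc N * E x))
      has_integral of_nat (Suc N) * integral {0..2 * pi} (\<lambda>x. of_real x ^ N * E x)
        - \<i> * of_int k * integral {0..2 * pi} (\<lambda>x. of_real x ^ Suc N * E x)) {0..2 * pi}"
    unfolding E_def
    by (intro has_integral_diff has_integral_mult_right integrable_integral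
          fourier_regular_integrable_exp fourier_regular_power)
  moreover have "E (2 * pi) = 1"
    using exp_periodic_int[of "- k" 0 1] by (simp add: E_def)
  ultimately have "of_nat (Suc N) * integral {0..2 * pi} (\<lambda>x. of_real x ^ N * E x)
        - \<i> * of_int k * integral {0..2 * pi} (\<lambda>x. of_real x ^ Suc N * E x) = of_real (2 * pi) ^ Suc N"
    by (simp add: has_integral_unique)
  then have "(of_nat (Suc N) * integral {0..2 * pi} (\<lambda>x. of_real x ^ N * E x)
        - \<i> * of_int k * integral {0..2 * pi} (\<lambda>x. of_real x ^ Suc N * E x)) / of_real (2 * pi)
      = of_real (2 * pi) ^ N"
    by (simp add: field_simps)
  then show ?thesis
    unfolding fourier_coeff_def E_def[symmetric] by (simp add: diff_divide_distrib)
qed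

lemma fourier_coeff_one:
  assumes "k \<noteq> 0"
  shows "fourier_coeff (\<lambda>x. of_real x ^ 0) k = 0"
proof -
  have "((\<lambda>x. exp (- \<i> * of_int k * of_real x)) has_integral
      exp (- \<i> * of_int k * of_real (2 * pi)) / (- \<i> * of_int k)
      - exp (- \<i> * of_int k * of_real 0) / (- \<i> * of_int k)) {0..2 * pi}"
  proof (rule fundamental_theorem_of_calculus)
    fix x :: real
    have "((\<lambda>z. exp (- \<i> * of_int k * z) / (- \<i> * of_int k)) has_field_derivative
       exp (- \<i> * of_int k * of_real x)) (at (of_real x))"
      using assms by (auto intro!: derivative_eq_intros)
    from has_vector_derivative_real_field[OF this]
    show "((\<lambda>x. exp (- \<i> * of_int k * of_real x) / (- \<i> * of_int k)) has_vector_derivative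
       exp (- \<i> * of_int k * of_real x)) (at x within {0..2 * pi})"
      by (rule has_vector_derivative_at_within)
  qed simp
  moreover have "exp (- \<i> * of_int k * of_real (2 * pi)) = 1"
    using exp_periodic_int[of "- k" 0 1] by simp
  ultimately show ?thesis
    by (simp add: fourier_coeff_def integral_unique)
qed

text \<open>Raising the exponent by one divides the previous expression by k and adds a boundary
  term, which supplies the next \<open>Q_recurrence_coeff\<close>.\<close>

lemma fourier_coeff_power:
  assumes "k \<noteq> 0"
  shows "- (\<i> ^ N / fact N) * fourier_coeff (\<lambda>x. of_real x ^ N) k
     = (\<Sum>m<N. Q_recurrence_coeff m / of_int k ^ (N - m))"
proof (induction N)
  case 0
  then show ?case using fourier_coeff_one[OF assms] by simp
next
  case (Suc N)
  define X where "X n = fourier_coeff (\<lambda>x. of_real x ^ n) k" for n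
  have "of_nat (Suc N) * X N - \<i> * of_int k * X (Suc N) = of_real (2 * pi) ^ N"
    unfolding X_def by (rule fourier_coeff_power_Suc)
  then have "Q_recurrence_coeff N = \<i> ^ N * (of_nat (Suc N) * X N - \<i> * of_int k * X (Suc N))
      / (of_nat (Suc N) * fact N)"
    by (simp add: Q_recurrence_coeff_def)
  then have "- (\<i> ^ Suc N / fact (Suc N)) * X (Suc N)
      = (- (\<i> ^ N / fact N) * X N + Q_recurrence_coeff N) / of_int k"
    using assms of_nat_neq_0[of N, where 'a=complex]
    by (simp add: field_simps del: of_nat_Suc)
  also have "\<dots> = (\<Sum>m<Suc N. Q_recurrence_coeff m / of_int k ^ (Suc N - m))"
  proof -
    have "(\<Sum>m<N. Q_recurrence_coeff m / of_int k ^ (N - m)) / of_int k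
        = (\<Sum>m<N. Q_recurrence_coeff m / of_int k ^ (Suc N - m))"
      unfolding sum_divide_distrib by (intro sum.cong refl) (auto simp: Suc_diff_le mult.commute)
    then show ?thesis using Suc.IH by (simp add: X_def add_divide_distrib)
  qed
  finally show ?case by (simp only: X_def)
qed

text \<open>By \<open>fourier_coeff_power\<close> the numbers 1 / k^l solve the same triangular
  system as the coefficients of \<open>Q_poly l\<close>, so in the induction step all lower terms
  cancel.\<close>

lemma fourier_coeff_Q_poly:
  assumes "N \<ge> 1" "k \<noteq> 0"
  shows "fourier_coeff (Q_poly N) k = 1 / of_int k ^ N"
  using assms(1)
proof (induction N rule: less_induct)
  case (less N)
  have "fourier_coeff (Q_poly N) k = - (\<i> ^ N / fact N) * fourier_coeff (\<lambda>x. of_real x ^ N) k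
     - (\<Sum>l\<in>{1..<N}. Q_recurrence_coeff (N - l) * fourier_coeff (Q_poly l) k)"
  proof -
    have "Q_poly N = (\<lambda>x. - (\<i> ^ N / fact N) * of_real x ^ N
        - (\<Sum>l\<in>{1..<N}. Q_recurrence_coeff (N - l) * Q_poly l x))"
      by (intro ext Q_poly_eq less.prems)
    then have "fourier_coeff (Q_poly N) k = fourier_coeff (\<lambda>x. - (\<i> ^ N / fact N) * of_real x ^ N) k
        - fourier_coeff (\<lambda>x. \<Sum>l\<in>{1..<N}. Q_recurrence_coeff (N - l) * Q_poly l x) k"
      by (simp only:) (intro fourier_coeff_diff fourier_regular_sum fourier_regular_cmult
            fourier_regular_power fourier_regular_Q_poly)
    also have "fourier_coeff (\<lambda>x. \<Sum>l\<in>{1..<N}. Q_recurrence_coeff (N - l) * Q_poly l x) k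
        = (\<Sum>l\<in>{1..<N}. fourier_coeff (\<lambda>x. Q_recurrence_coeff (N - l) * Q_poly l x) k)"
      by (intro fourier_coeff_sum fourier_regular_cmult fourier_regular_Q_poly) simp
    finally show ?thesis by (simp only: fourier_coeff_cmult)
  qed
  also have "(\<Sum>l\<in>{1..<N}. Q_recurrence_coeff (N - l) * fourier_coeff (Q_poly l) k)
     = (\<Sum>l\<in>{1..<N}. Q_recurrence_coeff (N - l) / of_int k ^ l)"
    using less.IH by (intro sum.cong refl) auto
  also have "\<dots> = (\<Sum>m\<in>{1..<N}. Q_recurrence_coeff m / of_int k ^ (N - m))"
    by (rule sum.reindex_bij_witness[of _ "\<lambda>m. N - m" "\<lambda>m. N - m"]) auto
  \<comment> \<open>The term m = 0 is set apart: its coefficient is 1, and it is the one that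
    survives.\<close>
  also have "- (\<i> ^ N / fact N) * fourier_coeff (\<lambda>x. of_real x ^ N) k
     = Q_recurrence_coeff 0 / of_int k ^ N + (\<Sum>m\<in>{1..<N}. Q_recurrence_coeff m / of_int k ^ (N - m))"
  proof -
    have "{..<N} = insert 0 {1..<N}" using less.prems by auto
    then show ?thesis unfolding fourier_coeff_power[OF assms(2)] by simp
  qed
  finally show ?case by (simp add: Q_recurrence_coeff_def)
qed

text \<open>N \<ge> 2 makes the sum of 1 / k^N converge. The resulting bound, uniform in n and y, is
  the dominating constant for the limit under the convolution integral.\<close>

lemma fourier_sum_Q_poly_bounded:
  assumes "N \<ge> 2"
  obtains C where "\<And>n y. norm (fourier_sum (Q_poly N) n y) \<le> C"
proof -
  define c where "c k = inverse (real (Suc k) ^ N)" for k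
  have "summable (\<lambda>k. inverse (real k ^ N))"
    using inverse_power_summable[OF assms, where 'a=real] .
  then have c: "summable c"
    unfolding c_def using summable_Suc_iff[of "\<lambda>k. inverse (real k ^ N)"] by blast
  have "norm (fourier_sum (Q_poly N) n y) \<le> norm (fourier_coeff (Q_poly N) 0) + 2 * suminf c" for n y
  proof -
    have "norm (fourier_sum (Q_poly N) n y) \<le> (\<Sum>k\<in>{- int n..int n}. norm (fourier_coeff (Q_poly N) k))"
      unfolding fourier_sum_def by (rule order_trans[OF norm_sum]) (simp add: norm_mult)
    also have "\<dots> = norm (fourier_coeff (Q_poly N) 0) + 2 * (\<Sum>k<n. c k)"
    proof (induction n)
      case (Suc n)
      have "norm (fourier_coeff (Q_poly N) (int (Suc n))) = c n"
        "norm (fourier_coeff (Q_poly N) (- int (Suc n))) = c n"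
        using assms fourier_coeff_Q_poly[of N "int (Suc n)"] fourier_coeff_Q_poly[of N "- int (Suc n)"]
        by (simp_all add: c_def norm_divide norm_power inverse_eq_divide del: of_nat_Suc)
      then show ?case unfolding sum_symmetric_Suc Suc by simp
    qed simp
    also have "(\<Sum>k<n. c k) \<le> suminf c"
      by (rule sum_le_suminf[OF c]) (auto simp: c_def)
    finally show ?thesis by simp
  qed
  then show thesis by (rule that)
qed

subsection \<open>Fourier series of a convolution\<close>

text \<open>Whole periods move the window so that it starts at some b in [0, 2\<pi>]; then [0, b] is
  carried one period to the right and joined to [b, 2\<pi>].\<close>

lemma has_integral_periodic:
  fixes F :: "real \<Rightarrow> complex"
  assumes F: "\<And>z j. F (z + 2 * pi * of_int j) = F z" and I: "(F has_integral I) {0..2 * pi}"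
  shows "(F has_integral I) {a..a + 2 * pi}"
proof -
  have shift: "(F has_integral J) {u + 2 * pi * of_int j..v + 2 * pi * of_int j} \<longleftrightarrow> (F has_integral J) {u..v}"
    for J u v and j :: int
  proof -
    have "F \<circ> (+) (2 * pi * of_int j) = F" using F by (simp add: fun_eq_iff add.commute)
    then show ?thesis using has_integral_shift_Icc_real[of F "2 * pi * of_int j" J u v] by simp
  qed
  define j where "j = \<lfloor>a / (2 * pi)\<rfloor>"
  define b where "b = a - 2 * pi * of_int j"
  have b: "0 \<le> b" "b \<le> 2 * pi" using periodic_ext_range[of a] by (simp_all add: b_def j_def)
  have "F integrable_on {0..b}" "F integrable_on {b..2 * pi}"
    using I b by (auto intro: integrable_subinterval_real[of F 0 "2 * pi"])
  then obtain A B where A: "(F has_integral A) {0..b}" and B: "(F has_integral B) {b..2 * pi}"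
    by (auto simp: integrable_on_def)
  have "I = A + B"
    using has_integral_combine[OF b A B] I has_integral_unique by blast
  moreover have "(F has_integral A) {0 + 2 * pi * of_int 1..b + 2 * pi * of_int 1}"
    unfolding shift by (rule A)
  then have "(F has_integral B + A) {b..b + 2 * pi}"
    using B b by (intro has_integral_combine[of b "2 * pi" "b + 2 * pi"]) auto
  ultimately have "(F has_integral I) {b..b + 2 * pi}" by (simp add: add.commute)
  then have "(F has_integral I) {b + 2 * pi * of_int j..b + 2 * pi + 2 * pi * of_int j}"
    unfolding shift .
  then show ?thesis by (simp add: b_def)
qed

text \<open>The substitution z = x - y turns exp (\<i>ky) into exp (\<i>kx) exp (-\<i>kz), and
  periodicity replaces the window [x - 2\<pi>, x] by [0, 2\<pi>].\<close>

lemma has_integral_conv_exp: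
  assumes h: "fourier_regular h"
  shows "((\<lambda>y. periodic_ext h (x - y) * exp (\<i> * of_int k * of_real y)) has_integral
     2 * of_real pi * fourier_coeff h k * exp (\<i> * of_int k * of_real x)) {0..2 * pi}"
    (is "(_ has_integral ?I) _")
proof -
  define F where "F z = periodic_ext h z * exp (\<i> * of_int k * of_real (x - z))" for z
  have E: "exp (\<i> * of_int k * of_real (x - z)) = exp (- \<i> * of_int k * of_real z) * exp (\<i> * of_int k * of_real x)" for z
    by (simp add: algebra_simps flip: exp_add)
  have "((\<lambda>z. h z * exp (- \<i> * of_int k * of_real z) * exp (\<i> * of_int k * of_real x)) has_integral
     integral {0..2 * pi} (\<lambda>z. h z * exp (- \<i> * of_int k * of_real z)) * exp (\<i> * of_int k * of_real x)) {0..2 * pi}"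
    by (intro has_integral_mult_left integrable_integral fourier_regular_integrable_exp h)
  moreover have "integral {0..2 * pi} (\<lambda>z. h z * exp (- \<i> * of_int k * of_real z)) = 2 * of_real pi * fourier_coeff h k"
    by (simp add: fourier_coeff_def)
  ultimately have "((\<lambda>z. h z * exp (- \<i> * of_int k * of_real z) * exp (\<i> * of_int k * of_real x)) has_integral ?I) {0..2 * pi}"
    by simp
  then have "(F has_integral ?I) {0..2 * pi}"
  \<comment> \<open>At 2\<pi> the extension takes the value \<open>h 0\<close> instead of
    \<open>h (2 * pi)\<close>, so that point is discarded.\<close>
  proof (rule has_integral_spike[of "{2 * pi}", rotated 2])
    show "F z = h z * exp (- \<i> * of_int k * of_real z) * exp (\<i> * of_int k * of_real x)"
      if "z \<in> {0..2 * pi} - {2 * pi}" for z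
      using that unfolding F_def E by (simp add: periodic_ext_id)
  qed simp
  moreover have "F (z + 2 * pi * of_int j) = F z" for z j
    using exp_periodic_int[of k "x - z" "- j"] unfolding F_def periodic_ext_shift
    by (simp add: algebra_simps)
  ultimately have "(F has_integral ?I) {x - 2 * pi..x - 2 * pi + 2 * pi}"
    by (intro has_integral_periodic)
  then have "((\<lambda>u. F (- u)) has_integral ?I) {0 + - x..2 * pi + - x}"
    using has_integral_reflect_real[of F ?I x "x - 2 * pi"] by simp
  then have "((\<lambda>u. F (- u)) \<circ> (+) (- x) has_integral ?I) {0..2 * pi}"
    unfolding has_integral_shift_Icc_real .
  then show ?thesis by (simp add: F_def o_def)
qed

text \<open>The factor Q is expanded, not h: its partial sums are bounded by C and converge inside
  the period, so dominated convergence applies at every x even where the series of h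
  misbehaves.\<close>

lemma periodic_conv_fourier:
  assumes h: "fourier_regular h" and Q: "fourier_regular Q" "continuous_on UNIV Q"
    and bound: "\<And>n y. norm (fourier_sum Q n y) \<le> C"
  shows "bilateral_sums (\<lambda>k. fourier_coeff h k * fourier_coeff Q k * exp (\<i> * of_int k * of_real x))
           (periodic_conv h Q x)"
proof -
  define P where "P y = periodic_ext h (x - y)" for y
  obtain B where B: "\<And>y. norm (P y) \<le> B"
  proof -
    obtain B where "\<forall>z\<in>{0..2 * pi}. norm (h z) \<le> B"
      using fourier_regular_bounded[OF h] unfolding bounded_iff by auto
    then show thesis
      using periodic_ext_range by (intro that[of B]) (fastforce simp: P_def periodic_ext_def)
  qed
  have B0: "B \<ge> 0" using B[of 0] norm_ge_zero order_trans by blast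
  have closed: "((\<lambda>y. P y * fourier_sum Q n y) has_integral
     (\<Sum>k\<in>{- int n..int n}. fourier_coeff Q k *
        (2 * of_real pi * fourier_coeff h k * exp (\<i> * of_int k * of_real x)))) {0..2 * pi}" for n
  proof -
    have "P y * fourier_sum Q n y = (\<Sum>k\<in>{- int n..int n}. fourier_coeff Q k * (P y * exp (\<i> * of_int k * of_real y)))" for y
      by (simp add: fourier_sum_def sum_distrib_left algebra_simps)
    then show ?thesis
      unfolding P_def by (simp only:) (intro has_integral_sum has_integral_mult_right has_integral_conv_exp h, simp)
  qed
  \<comment> \<open>The open interval avoids the endpoints, where the periodic extension of Q may
    jump.\<close>
  have "(\<lambda>n. integral {0<..<2 * pi} (\<lambda>y. P y * fourier_sum Q n y)) \<longlonglongrightarrow>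
      integral {0<..<2 * pi} (\<lambda>y. P y * periodic_ext Q y)"
  proof (rule dominated_convergence(2))
    show "(\<lambda>y. P y * fourier_sum Q n y) integrable_on {0<..<2 * pi}" for n
      using closed[of n] unfolding integrable_on_open_interval_real by (rule has_integral_integrable)
    show "(\<lambda>y. B * C) integrable_on {0<..<2 * pi}"
      unfolding integrable_on_open_interval_real by (rule integrable_const_ivl)
    show "norm (P y * fourier_sum Q n y) \<le> B * C" for n y
      unfolding norm_mult by (intro mult_mono B bound B0) auto
    show "(\<lambda>n. P y * fourier_sum Q n y) \<longlonglongrightarrow> P y * periodic_ext Q y" if y: "y \<in> {0<..<2 * pi}" for y
    proof (intro tendsto_mult_left fourier_regular_limit Q equals_jump_mean_at_if_isCont)
      have "isCont Q y" using Q(2) by (simp add: continuous_on_eq_continuous_at)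
      moreover have "\<forall>\<^sub>F z in nhds y. periodic_ext Q z = Q z"
        by (rule eventually_mono[OF eventually_nhds_in_open[OF _ y]]) (auto simp: periodic_ext_id)
      ultimately show "isCont (periodic_ext Q) y"
        using isCont_cong by blast
    qed
  qed
  then have "(\<lambda>n. 1 / (2 * of_real pi) * integral {0..2 * pi} (\<lambda>y. P y * fourier_sum Q n y)) \<longlonglongrightarrow>
      1 / (2 * of_real pi) * integral {0..2 * pi} (\<lambda>y. P y * periodic_ext Q y)"
    unfolding integral_open_interval_real by (rule tendsto_mult_left)
  moreover have "1 / (2 * of_real pi) * integral {0..2 * pi} (\<lambda>y. P y * fourier_sum Q n y)
     = (\<Sum>k\<in>{- int n..int n}. fourier_coeff h k * fourier_coeff Q k * exp (\<i> * of_int k * of_real x))" for n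
    unfolding integral_unique[OF closed] sum_distrib_left
    by (intro sum.cong refl) simp
  ultimately show ?thesis
    by (simp add: bilateral_sums_def periodic_conv_def P_def)
qed

subsection \<open>Periodic multipliers\<close>

lemma sum_roots_of_unity_int:
  fixes M :: nat and d :: int
  assumes "M > 0"
  shows "(\<Sum>j<M. exp (\<i> * of_int d * of_real (2 * pi * real j / real M)))
     = (if int M dvd d then of_nat M else 0)"
proof -
  define w where "w = exp (\<i> * of_int d * of_real (2 * pi / real M))"
  have pow: "exp (\<i> * of_int d * of_real (2 * pi * real j / real M)) = w ^ j" for j
    by (simp add: w_def algebra_simps flip: exp_of_nat_mult)
  have w1: "w = 1 \<longleftrightarrow> int M dvd d"
  proof
    assume "w = 1"
    then obtain n :: int where "Im (\<i> * of_int d * of_real (2 * pi / real M)) = of_int (2 * n) * pi"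
      unfolding w_def exp_eq_1 by blast
    then have "real_of_int d = real_of_int (n * int M)"
      using assms by (simp add: field_simps)
    then have "d = n * int M" by (simp only: of_int_eq_iff)
    then show "int M dvd d" by simp
  next
    assume "int M dvd d"
    then obtain n where "d = int M * n" by auto
    then have "\<i> * of_int d * of_real (2 * pi / real M) = \<i> * of_int n * of_real (0 + 2 * pi * of_int 1)"
      using assms by (simp add: field_simps)
    then show "w = 1" unfolding w_def by (simp only: exp_periodic_int) simp
  qed
  show ?thesis
  proof (cases "int M dvd d")
    case True
    then show ?thesis unfolding pow using w1 by simp
  next
    case False
    have "w ^ M = exp (\<i> * of_int d * of_real (0 + 2 * pi * of_int 1))"
      using pow[of M] assms by simp
    also have "\<dots> = 1" by (simp only: exp_periodic_int) simp
    finally show ?thesis unfolding pow using False w1 geometric_sum[of w M] by simp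
  qed
qed

text \<open>The positive exponent is placed here so that the inversion formula carries exp (-\<i>k
  2\<pi>j / M), which for M = 2 q turns f(x) into f(x - \<pi>j / q).\<close>

definition discrete_fourier :: "nat \<Rightarrow> (int \<Rightarrow> complex) \<Rightarrow> nat \<Rightarrow> complex"
  where "discrete_fourier M F j =
    1 / of_nat M * (\<Sum>m<M. F (int m) * exp (\<i> * of_int (int m) * of_real (2 * pi * real j / real M)))"

lemma discrete_fourier_inversion:
  fixes M :: nat
  assumes M: "M > 0" and F: "\<And>k m. [k = m] (mod int M) \<Longrightarrow> F k = F m"
  shows "F k = (\<Sum>j<M. discrete_fourier M F j * exp (- (\<i> * of_int k * of_real (2 * pi * real j / real M))))"
proof -
  have "(\<Sum>j<M. discrete_fourier M F j * exp (- (\<i> * of_int k * of_real (2 * pi * real j / real M))))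
     = (\<Sum>j<M. \<Sum>m<M. 1 / of_nat M * F (int m) * exp (\<i> * of_int (int m - k) * of_real (2 * pi * real j / real M)))"
  proof -
    have "exp (\<i> * of_int (int m - k) * z) = exp (\<i> * of_int (int m) * z) * exp (- (\<i> * of_int k * z))" for m z
      by (simp add: algebra_simps flip: exp_add)
    then show ?thesis
      unfolding discrete_fourier_def sum_distrib_left sum_distrib_right
      by (simp only: mult.assoc)
  qed
  also have "\<dots> = (\<Sum>m<M. 1 / of_nat M * F (int m) * (\<Sum>j<M. exp (\<i> * of_int (int m - k) * of_real (2 * pi * real j / real M))))"
    unfolding sum_distrib_left by (rule sum.swap)
  \<comment> \<open>Orthogonality of the characters leaves only the representative of k among 0,
    ..., M - 1; k may be negative, hence the integer \<open>mod\<close> before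
    \<open>nat\<close>.\<close>
  also have "\<dots> = (\<Sum>m<M. if m = nat (k mod int M) then F k else 0)"
  proof (intro sum.cong refl)
    fix m assume "m \<in> {..<M}"
    then have m: "m < M" by simp
    have "int M dvd int m - k \<longleftrightarrow> [int m = k] (mod int M)"
      by (simp add: cong_iff_dvd_diff)
    moreover have "[int m = k] (mod int M) \<longleftrightarrow> m = nat (k mod int M)"
      using m by (auto simp: cong_def nat_eq_iff)
    ultimately show "1 / of_nat M * F (int m) * (\<Sum>j<M. exp (\<i> * of_int (int m - k) * of_real (2 * pi * real j / real M)))
        = (if m = nat (k mod int M) then F k else 0)"
      unfolding sum_roots_of_unity_int[OF M] using F[of "int m" k] M by auto
  qed
  also have "\<dots> = F k"
    using M by (simp add: nat_less_iff)
  finally show ?thesis ..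
qed

text \<open>Congruence survives the N-th power, so the arguments differ by 2\<pi> times an integer.
  With t = \<pi> p / q it is the modulus 2 q, rather than q, that produces whole multiples of
  2\<pi>.\<close>

lemma periodic_trig_power:
  fixes p q N :: nat
  assumes "q > 0" and "[k = m] (mod int (2 * q))"
  shows "cos (of_int k ^ N * (pi * real p / real q)) = cos (of_int m ^ N * (pi * real p / real q))"
    and "sin (of_int k ^ N * (pi * real p / real q)) = sin (of_int m ^ N * (pi * real p / real q))"
proof -
  have "[m ^ N = k ^ N] (mod int (2 * q))" by (intro cong_pow cong_sym[OF assms(2)])
  then obtain l where l: "k ^ N = m ^ N + int (2 * q) * l"
    unfolding cong_iff_lin by blast
  have "real_of_int k ^ N = of_int m ^ N + 2 * real q * of_int l"
    using arg_cong[OF l, of real_of_int] by simp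
  then have "of_int k ^ N * (pi * real p / real q) = of_int m ^ N * (pi * real p / real q) + 2 * pi * of_int (l * int p)"
    using assms(1) by (simp add: field_simps)
  then show "cos (of_int k ^ N * (pi * real p / real q)) = cos (of_int m ^ N * (pi * real p / real q))"
    and "sin (of_int k ^ N * (pi * real p / real q)) = sin (of_int m ^ N * (pi * real p / real q))"
    by (simp_all only: sin_add cos_add sin_int_2pin cos_int_2pin mult_zero_right mult_1_right add_0_right diff_zero)
qed

text \<open>The coefficients may depend on \<open>p / q\<close> only, so \<open>q\<close> has to be recovered from it.\<close>

definition reduced_denominator :: "real \<Rightarrow> nat"
  where "reduced_denominator r = (THE q. \<exists>p. q > 0 \<and> coprime p q \<and> r = real p / real q)"

lemma reduced_denominator_eq:
  assumes "q > 0" "coprime p q"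
  shows "reduced_denominator (real p / real q) = q"
  unfolding reduced_denominator_def
proof (rule the_equality)
  fix q' assume "\<exists>p'. q' > 0 \<and> coprime p' q' \<and> real p / real q = real p' / real q'"
  then obtain p' where p': "q' > 0" "coprime p' q'" "real p / real q = real p' / real q'" by blast
  then have "real (p * q') = real (p' * q)" using assms by (simp add: field_simps)
  then have eq: "p * q' = p' * q" by (simp only: of_nat_eq_iff)
  have "q dvd p * q'" "q' dvd p' * q" by (metis eq dvd_triv_right)+
  then have "q dvd q'" "q' dvd q"
    using assms(2) p'(2) by (simp_all add: coprime_dvd_mult_right_iff coprime_commute)
  then show "q' = q" by (rule dvd_antisym[rotated])
qed (use assms in blast)

text \<open>Each symmetric partial sum is already a finite combination of translated partial sums,
  so the limit is taken separately for each j and conditional convergence suffices.\<close>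

lemma modulated_fourier_sum:
  fixes q :: nat and F c :: "int \<Rightarrow> complex" and s :: "nat \<Rightarrow> complex"
  assumes q: "q > 0" and F: "\<And>k m. [k = m] (mod int (2 * q)) \<Longrightarrow> F k = F m"
    and lim: "\<And>j. j < 2 * q \<Longrightarrow>
      bilateral_sums (\<lambda>k. c k * exp (\<i> * of_int k * of_real (x - pi * real j / real q))) (s j)"
  shows "bilateral_sums (\<lambda>k. c k * F k * exp (\<i> * of_int k * of_real x))
      (\<Sum>j<2 * q. discrete_fourier (2 * q) F j * s j)"
proof -
  have "c k * F k * exp (\<i> * of_int k * of_real x) = (\<Sum>j<2 * q. discrete_fourier (2 * q) F j *
        (c k * exp (\<i> * of_int k * of_real (x - pi * real j / real q))))" for k
  proof -
    have "c k * F k * exp (\<i> * of_int k * of_real x) = (\<Sum>j<2 * q. c k * (discrete_fourier (2 * q) F j *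
        exp (- (\<i> * of_int k * of_real (2 * pi * real j / real (2 * q))))) * exp (\<i> * of_int k * of_real x))"
      unfolding sum_distrib_left[symmetric] sum_distrib_right[symmetric]
      using discrete_fourier_inversion[of "2 * q" F k, OF _ F] q by (simp only: mult_pos_pos zero_less_numeral)
    also have "\<dots> = (\<Sum>j<2 * q. discrete_fourier (2 * q) F j *
        (c k * exp (\<i> * of_int k * of_real (x - pi * real j / real q))))"
    proof (intro sum.cong refl)
      fix j
      have "exp (- (\<i> * of_int k * of_real (2 * pi * real j / real (2 * q)))) * exp (\<i> * of_int k * of_real x)
         = exp (\<i> * of_int k * of_real (x - pi * real j / real q))"
        using q by (simp add: right_diff_distrib flip: exp_add)
      then show "c k * (discrete_fourier (2 * q) F j * exp (- (\<i> * of_int k * of_real (2 * pi * real j / real (2 * q)))))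
          * exp (\<i> * of_int k * of_real x) = discrete_fourier (2 * q) F j *
          (c k * exp (\<i> * of_int k * of_real (x - pi * real j / real q)))"
        by (metis mult.assoc mult.left_commute)
    qed
    finally show ?thesis .
  qed
  then have "(\<Sum>k\<in>{- int n..int n}. c k * F k * exp (\<i> * of_int k * of_real x))
      = (\<Sum>j<2 * q. discrete_fourier (2 * q) F j *
          (\<Sum>k\<in>{- int n..int n}. c k * exp (\<i> * of_int k * of_real (x - pi * real j / real q))))" for n
    by (simp only: sum_distrib_left) (rule sum.swap)
  then show ?thesis
    using lim unfolding bilateral_sums_def by (auto intro!: tendsto_sum tendsto_mult_left)
qed

section \<open>Assembling the solution at a rational time\<close>

lemma bilateral_sums_add:
  "bilateral_sums c s \<Longrightarrow> bilateral_sums c' s' \<Longrightarrow> bilateral_sums (\<lambda>k. c k + c' k) (s + s')"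
  unfolding bilateral_sums_def sum.distrib by (rule tendsto_add)

lemma bilateral_sums_single: "bilateral_sums (\<lambda>k. if k = 0 then c else 0) c"
  by (simp add: bilateral_sums_def)

lemma periodic_ext_periodic_conv: "periodic_ext (periodic_conv h Q) x = periodic_conv h Q x"
proof -
  have "periodic_ext h (x - 2 * pi * of_int j - y) = periodic_ext h (x - y)" for j y
    using periodic_ext_shift[of h "x - 2 * pi * of_int j - y" j] by simp
  then show ?thesis by (simp add: periodic_ext_def[of "periodic_conv h Q"] periodic_conv_def)
qed

lemma fourier_coeff_minus_mean:
  assumes "fourier_regular g"
  shows "fourier_coeff (\<lambda>y. g y - mean_value g) k = (if k = 0 then 0 else fourier_coeff g k)"
proof -
  have c: "fourier_coeff (\<lambda>y. c) k = (if k = 0 then c else 0)" for c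
    using fourier_coeff_cmult[of c "\<lambda>x. of_real x ^ 0" k] fourier_coeff_one[of k]
    by (auto simp: fourier_coeff_def scaleR_conv_of_real)
  show ?thesis
    using fourier_coeff_diff[OF assms fourier_regular_const, of "mean_value g" k]
    by (simp add: c fourier_coeff_0)
qed

text \<open>The coefficients are quantified before p, q and the data, so for given N and L they
  depend only on j and p / q. E collects the points where a translate of \<open>f\<close> has a
  value that its Fourier series cannot reproduce; v contributes none, since its series converges to
  it everywhere.\<close>

theorem theorem3p8:
  fixes N :: nat and L :: "int \<Rightarrow> complex"
  assumes "N \<ge> 2"
    and "\<And>k. L k = - (of_int k ^ (2 * N))"
  shows "\<exists>a d :: nat \<Rightarrow> real \<Rightarrow> complex.
    \<forall>(p::nat) (q::nat) (f :: real \<Rightarrow> complex) (g :: real \<Rightarrow> complex) (u :: real \<Rightarrow> real \<Rightarrow> complex).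
      p > 0 \<and> q > 0 \<and> coprime p q \<and>
      has_bounded_variation_on f 0 (2 * pi) \<and> has_bounded_variation_on g 0 (2 * pi) \<and>
      periodic_solution L f g u \<longrightarrow>
      (let t = pi * real p / real q;
           v = periodic_conv (\<lambda>y. g y - mean_value g) (Q_poly N);
           E = {x \<in> {0..2 * pi}. \<exists>j<2 * q.
                  \<not> equals_jump_mean_at (periodic_ext f) (x - pi * real j / real q)}
       in countable E \<and>
          (\<forall>x \<in> {0..2 * pi} - E.
             u t x = (\<Sum>j<2 * q. a j (real p / real q) * periodic_ext f (x - pi * real j / real q))
                     + mean_value g * of_real t
                     + (\<Sum>j<2 * q. d j (real p / real q) * periodic_ext v (x - pi * real j / real q))))"
proof -
  \<comment> \<open>At r = p / q these are the discrete Fourier coefficients of the factors cos (k^N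
    t) and sin (k^N t) over their period 2 q, with q read off from r.\<close>
  define a :: "nat \<Rightarrow> real \<Rightarrow> complex" where "a j r =
    discrete_fourier (2 * reduced_denominator r) (\<lambda>k. of_real (cos (of_int k ^ N * (pi * r)))) j" for j r
  define d :: "nat \<Rightarrow> real \<Rightarrow> complex" where "d j r =
    discrete_fourier (2 * reduced_denominator r) (\<lambda>k. of_real (sin (of_int k ^ N * (pi * r)))) j" for j r
  show ?thesis
  proof (rule exI[of _ a], rule exI[of _ d], intro allI impI, unfold Let_def, intro conjI ballI)
    fix p q :: nat and f g u
    assume asm: "p > 0 \<and> q > 0 \<and> coprime p q \<and>
      has_bounded_variation_on f 0 (2 * pi) \<and> has_bounded_variation_on g 0 (2 * pi) \<and>
      periodic_solution L f g u"
    then have q: "q > 0" and cop: "coprime p q" by auto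
    have f: "fourier_regular f" and g: "fourier_regular g"
      using asm by (auto intro: fourier_regular_bounded_variation)
    let ?E = "{x \<in> {0..2 * pi}. \<exists>j<2 * q.
                  \<not> equals_jump_mean_at (periodic_ext f) (x - pi * real j / real q)}"
    have "?E \<subseteq> (\<Union>j. (\<lambda>z. z + pi * real j / real q) ` {x. \<not> isCont (periodic_ext f) x})"
    proof
      fix x assume "x \<in> ?E"
      then obtain j where "\<not> isCont (periodic_ext f) (x - pi * real j / real q)"
        using equals_jump_mean_at_if_isCont by blast
      then have "x \<in> (\<lambda>z. z + pi * real j / real q) ` {x. \<not> isCont (periodic_ext f) x}"
        by (intro image_eqI[of _ _ "x - pi * real j / real q"]) auto
      then show "x \<in> (\<Union>j. (\<lambda>z. z + pi * real j / real q) ` {x. \<not> isCont (periodic_ext f) x})"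
        by blast
    qed
    moreover have "countable (\<Union>j. (\<lambda>z. z + pi * real j / real q) ` {x. \<not> isCont (periodic_ext f) x})"
      using fourier_regular_countable[OF f] by (intro countable_UN countable_image) auto
    ultimately show "countable ?E" by (rule countable_subset)
    fix x assume x: "x \<in> {0..2 * pi} - ?E"
    define t where "t = pi * real p / real q"
    define h where "h y = g y - mean_value g" for y
    define v where "v = periodic_conv h (Q_poly N)"
    define C where "C k = complex_of_real (cos (of_int k ^ N * t))" for k :: int
    define S where "S k = complex_of_real (sin (of_int k ^ N * t))" for k :: int
    have a: "a j (real p / real q) = discrete_fourier (2 * q) C j"
      and d: "d j (real p / real q) = discrete_fourier (2 * q) S j" for j
      unfolding a_def d_def reduced_denominator_eq[OF q cop] C_def[abs_def] S_def[abs_def] t_def by simp_all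
    have h: "fourier_regular h"
      unfolding h_def by (intro fourier_regular_diff g fourier_regular_const)
    obtain B where B: "\<And>n y. norm (fourier_sum (Q_poly N) n y) \<le> B"
      using fourier_sum_Q_poly_bounded[OF assms(1)] by blast
    have "bilateral_sums (\<lambda>k. fourier_coeff f k * C k * exp (\<i> * of_int k * of_real x))
        (\<Sum>j<2 * q. a j (real p / real q) * periodic_ext f (x - pi * real j / real q))"
      unfolding a
    proof (rule modulated_fourier_sum[OF q])
      show "C k = C m" if "[k = m] (mod int (2 * q))" for k m
        unfolding C_def t_def periodic_trig_power[OF q that] ..
      show "bilateral_sums (\<lambda>k. fourier_coeff f k * exp (\<i> * of_int k * of_real (x - pi * real j / real q)))
          (periodic_ext f (x - pi * real j / real q))" if "j < 2 * q" for j
        using fourier_regular_limit[OF f, of "x - pi * real j / real q"] x that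
        by (auto simp: bilateral_sums_def fourier_sum_def)
    qed
    moreover have "bilateral_sums (\<lambda>k. fourier_coeff h k * fourier_coeff (Q_poly N) k * S k * exp (\<i> * of_int k * of_real x))
        (\<Sum>j<2 * q. d j (real p / real q) * periodic_ext v (x - pi * real j / real q))"
      unfolding d
    proof (rule modulated_fourier_sum[OF q])
      show "S k = S m" if "[k = m] (mod int (2 * q))" for k m
        unfolding S_def t_def periodic_trig_power[OF q that] ..
      show "bilateral_sums (\<lambda>k. fourier_coeff h k * fourier_coeff (Q_poly N) k *
          exp (\<i> * of_int k * of_real (x - pi * real j / real q)))
          (periodic_ext v (x - pi * real j / real q))" for j
        unfolding v_def periodic_ext_periodic_conv
        by (rule periodic_conv_fourier[OF h fourier_regular_Q_poly continuous_on_Q_poly B])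
    qed
    ultimately have "bilateral_sums (\<lambda>k. fourier_coeff f k * C k * exp (\<i> * of_int k * of_real x)
        + (if k = 0 then mean_value g * of_real t else 0)
        + fourier_coeff h k * fourier_coeff (Q_poly N) k * S k * exp (\<i> * of_int k * of_real x))
       ((\<Sum>j<2 * q. a j (real p / real q) * periodic_ext f (x - pi * real j / real q))
        + mean_value g * of_real t
        + (\<Sum>j<2 * q. d j (real p / real q) * periodic_ext v (x - pi * real j / real q)))"
      by (intro bilateral_sums_add bilateral_sums_single)
    \<comment> \<open>For k \<noteq> 0 the coefficient of \<open>Q_poly N\<close> is the factor 1 /
      k^N; at k = 0 the product with the coefficient of \<open>h\<close> is 0 and the exponential is
      1.\<close>
    moreover have "fourier_coeff f k * C k * exp (\<i> * of_int k * of_real x)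
        + (if k = 0 then mean_value g * of_real t else 0)
        + fourier_coeff h k * fourier_coeff (Q_poly N) k * S k * exp (\<i> * of_int k * of_real x)
       = explicit_mode N f g k t * exp (\<i> * of_int k * of_real x)" for k
      using assms(1) fourier_coeff_Q_poly[of N k]
      by (simp add: explicit_mode_def C_def S_def h_def[abs_def] fourier_coeff_minus_mean[OF g] distrib_right)
    ultimately have "bilateral_sums (\<lambda>k. explicit_mode N f g k t * exp (\<i> * of_int k * of_real x))
       ((\<Sum>j<2 * q. a j (real p / real q) * periodic_ext f (x - pi * real j / real q))
        + mean_value g * of_real t
        + (\<Sum>j<2 * q. d j (real p / real q) * periodic_ext v (x - pi * real j / real q)))"
      by (simp only:)
    \<comment> \<open>\<open>periodic_solution\<close> fixes u only through convergent series. The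
      modes being unique, the convergence just shown is that of the series of \<open>c\<close>,
      which forces the value of u.\<close>
    moreover obtain c where "solution_modes L f g c"
      "\<And>t x s. bilateral_sums (\<lambda>k. c k t * exp (\<i> * of_int k * of_real x)) s \<Longrightarrow> u t x = s"
      using asm unfolding periodic_solution_def by blast
    moreover have "c = explicit_mode N f g"
      using solution_modes_iff[of N L f g c] assms calculation(2) by simp
    ultimately show "u (pi * real p / real q) x =
        (\<Sum>j<2 * q. a j (real p / real q) * periodic_ext f (x - pi * real j / real q))
        + mean_value g * of_real (pi * real p / real q)
        + (\<Sum>j<2 * q. d j (real p / real q) *
            periodic_ext (periodic_conv (\<lambda>y. g y - mean_value g) (Q_poly N)) (x - pi * real j / real q))"
      unfolding t_def v_def h_def[abs_def] by blast
  qed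
qed

end
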